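(* Let $\mathbb{H}^+=\{\xi\in\mathbb{H}^n:\langle\xi,\nu\rangle>d\}$ be a half-space of the Heisenberg group $\mathbb{H}^n$. Then for all $p>1$ and all $u\in C_0^\infty(\mathbb{H}^+)$, $$\int_{\mathbb{H}^+}|\nabla_Hu|^p\,d\xi\;\geq\;\left(\frac{p-1}{p}\right)^p\int_{\mathbb{H}^+}\frac{\mathcal{W}(\xi)^p}{dist(\xi,\partial\mathbb{H}^+)^p}|u|^p\,d\xi.$$ Moreover, the constant $\left(\frac{p-1}{p}\right)^p$ is sharp: for no $p>1$ can it be replaced by a larger constant such that the inequality still holds for all half-spaces $\mathbb{H}^+$ of $\mathbb{H}^n$ and all $u\in C_0^\infty(\mathbb{H}^+)$.
   Context: The Heisenberg group $\mathbb{H}^n$ is $\mathbb{R}^{2n+1}$ with points $\xi=(x,y,t)$, $x,y\in\mathbb{R}^n$, $t\in\mathbb{R}$, and group law $\xi\circ\widetilde\xi=\left(x+\widetilde x,\,y+\widetilde y,\,t+\widetilde t+2\sum_{i=1}^n(\widetilde x_iy_i-x_i\widetilde y_i)\right)$. Its left-invariant horizontal vector fields are $X_i=\frac{\partial}{\partial x_i}+2y_i\frac{\partial}{\partial t}$ and $Y_i=\frac{\partial}{\partial y_i}-2x_i\frac{\partial}{\partial t}$, $1\le i\le n$; the horizontal gradient is $\nabla_H=(X_1,\ldots,X_n,Y_1,\ldots,Y_n)$. $d\xi$ is Lebesgue measure on $\mathbb{R}^{2n+1}$ and $|\cdot|$ the Euclidean norm. A half-space is $\mathbb{H}^+=\{\xi\in\mathbb{H}^n:\langle\xi,\nu\rangle>d\}$,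 where $d\in\mathbb{R}$, $\nu=(\nu_x,\nu_y,\nu_t)$ with $\nu_x,\nu_y\in\mathbb{R}^n$, $\nu_t\in\mathbb{R}$ is the unit normal to the boundary $\partial\mathbb{H}^+$ (a unit vector of $\mathbb{R}^{2n+1}$), and $\langle\cdot,\cdot\rangle$ is the Euclidean inner product on $\mathbb{R}^{2n+1}$. The distance to the boundary is $dist(\xi,\partial\mathbb{H}^+)=\langle\xi,\nu\rangle-d$. Writing $X_i(\xi),Y_i(\xi)\in\mathbb{R}^{2n+1}$ for the coefficient vectors of $X_i,Y_i$ at $\xi$, so that $\langle X_i(\xi),\nu\rangle=\nu_{x,i}+2y_i\nu_t$ and $\langle Y_i(\xi),\nu\rangle=\nu_{y,i}-2x_i\nu_t$, the angle function is $\mathcal{W}(\xi)=\left(\sum_{i=1}^n\langle X_i(\xi),\nu\rangle^2+\langle Y_i(\xi),\nu\rangle^2\right)^{1/2}$. *)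

theory Defs
  imports "HOL-Analysis.Analysis"
begin

text \<open>
  Points \<open>(x, y, t)\<close> of the Heisenberg group. The product instances provide the Euclidean
  inner product, norm and Lebesgue measure of \<open>\<real>\<^sup>2\<^sup>n\<^sup>+\<^sup>1\<close>, where \<open>n = CARD('n) \<ge> 1\<close>.
\<close>

type_synonym 'n heisenberg = "(real ^ 'n) \<times> (real ^ 'n) \<times> real"

text \<open>Coefficient vectors of \<open>X\<^sub>i = \<partial>/\<partial>x\<^sub>i + 2 y\<^sub>i \<partial>/\<partial>t\<close> and \<open>Y\<^sub>i = \<partial>/\<partial>y\<^sub>i - 2 x\<^sub>i \<partial>/\<partial>t\<close>.\<close>

definition X_field :: "'n::finite \<Rightarrow> 'n heisenberg \<Rightarrow> 'n heisenberg" where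
  "X_field i = (\<lambda>(x, y, t). (axis i 1, 0, 2 * y $ i))"

definition Y_field :: "'n::finite \<Rightarrow> 'n heisenberg \<Rightarrow> 'n heisenberg" where
  "Y_field i = (\<lambda>(x, y, t). (0, axis i 1, - 2 * x $ i))"

definition horizontal_gradient ::
    "('n::finite heisenberg \<Rightarrow> real) \<Rightarrow> 'n heisenberg \<Rightarrow> (real ^ 'n) \<times> (real ^ 'n)" where
  "horizontal_gradient u \<xi> =
     ((\<chi> i. frechet_derivative u (at \<xi>) (X_field i \<xi>)),
      (\<chi> i. frechet_derivative u (at \<xi>) (Y_field i \<xi>)))"

definition half_space :: "'n::finite heisenberg \<Rightarrow> real \<Rightarrow> 'n heisenberg set" where
  "half_space \<nu> d = {\<xi>. \<xi> \<bullet> \<nu> > d}"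

text \<open>
  Signed distance to the boundary of \<open>half_space \<nu> d\<close>; for a unit vector \<open>\<nu>\<close> it is the
  Euclidean distance inside the half-space, see \<open>boundary_dist_eq_infdist\<close> below.
\<close>

definition boundary_dist :: "'n::finite heisenberg \<Rightarrow> real \<Rightarrow> 'n heisenberg \<Rightarrow> real" where
  "boundary_dist \<nu> d \<xi> = \<xi> \<bullet> \<nu> - d"

definition angle_function :: "'n::finite heisenberg \<Rightarrow> 'n heisenberg \<Rightarrow> real" where
  "angle_function \<nu> \<xi> = sqrt (\<Sum>i\<in>UNIV. (X_field i \<xi> \<bullet> \<nu>)\<^sup>2 + (Y_field i \<xi> \<bullet> \<nu>)\<^sup>2)"

text \<open>\<open>C\<^sup>k\<close> on the whole space, through iterated directional derivatives.\<close>

primrec C_k :: "nat \<Rightarrow> ('a::euclidean_space \<Rightarrow> real) \<Rightarrow> bool" where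
  "C_k 0 f \<longleftrightarrow> continuous_on UNIV f"
| "C_k (Suc k) f \<longleftrightarrow>
     (\<forall>x. f differentiable (at x)) \<and> (\<forall>v. C_k k (\<lambda>x. frechet_derivative f (at x) v))"

text \<open>\<open>C\<^sub>0\<^sup>\<infinity>(S)\<close> for open \<open>S\<close>; its members are extended by zero to the whole space.\<close>

definition test_functions :: "'a::euclidean_space set \<Rightarrow> ('a \<Rightarrow> real) set" where
  "test_functions S =
     {u. (\<forall>k. C_k k u) \<and> compact (closure {x. u x \<noteq> 0}) \<and> closure {x. u x \<noteq> 0} \<subseteq> S}"

lemma inner_X_field:
  "X_field i (x, y, t) \<bullet> (\<nu>\<^sub>x, \<nu>\<^sub>y, \<nu>\<^sub>t) = \<nu>\<^sub>x $ i + 2 * y $ i * \<nu>\<^sub>t"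
  by (simp add: X_field_def inner_axis')

lemma inner_Y_field:
  "Y_field i (x, y, t) \<bullet> (\<nu>\<^sub>x, \<nu>\<^sub>y, \<nu>\<^sub>t) = \<nu>\<^sub>y $ i - 2 * x $ i * \<nu>\<^sub>t"
  by (simp add: Y_field_def inner_axis')

lemma frontier_half_space:
  assumes "norm \<nu> = 1"
  shows "frontier (half_space \<nu> d) = {\<xi>. \<xi> \<bullet> \<nu> = d}"
proof -
  have "\<nu> \<noteq> 0" using assms by auto
  then show ?thesis
    using frontier_halfspace_gt[of \<nu> d] by (simp add: half_space_def inner_commute)
qed

lemma boundary_dist_eq_infdist:
  assumes "norm \<nu> = 1" "\<xi> \<in> half_space \<nu> d"
  shows "boundary_dist \<nu> d \<xi> = infdist \<xi> (frontier (half_space \<nu> d))"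
proof -
  let ?B = "{\<eta>. \<eta> \<bullet> \<nu> = d}"
  let ?\<eta> = "\<xi> - (\<xi> \<bullet> \<nu> - d) *\<^sub>R \<nu>"
  have nn: "\<nu> \<bullet> \<nu> = 1" using assms(1) by (simp add: norm_eq_1)
  have \<eta>: "?\<eta> \<in> ?B" by (simp add: inner_diff_left nn)
  have "infdist \<xi> ?B \<le> dist \<xi> ?\<eta>" by (rule infdist_le[OF \<eta>])
  also have "\<dots> = \<xi> \<bullet> \<nu> - d" using assms by (simp add: dist_norm half_space_def)
  finally have le: "infdist \<xi> ?B \<le> \<xi> \<bullet> \<nu> - d" .
  have "\<xi> \<bullet> \<nu> - d \<le> dist \<xi> \<eta>" if "\<eta> \<in> ?B" for \<eta>
  proof -
    have "\<xi> \<bullet> \<nu> - d = (\<xi> - \<eta>) \<bullet> \<nu>" using that by (simp add: inner_diff_left)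
    also have "\<dots> \<le> norm (\<xi> - \<eta>) * norm \<nu>" by (rule norm_cauchy_schwarz)
    finally show ?thesis using assms(1) by (simp add: dist_norm)
  qed
  moreover have "?B \<noteq> {}" using \<eta> by blast
  ultimately have "\<xi> \<bullet> \<nu> - d \<le> infdist \<xi> ?B"
    unfolding infdist_notempty[OF \<open>?B \<noteq> {}\<close>] by (intro cINF_greatest)
  with le show ?thesis by (simp add: boundary_dist_def frontier_half_space[OF assms(1)])
qed

end

theory Submission
  imports Defs
begin

text \<open>
  The horizontal field \<open>V = \<Sum>\<^sub>i \<langle>X\<^sub>i, \<nu>\<rangle> X\<^sub>i + \<langle>Y\<^sub>i, \<nu>\<rangle> Y\<^sub>i\<close> is divergence free, leaves the angle
  function \<open>W\<close> invariant, and the distance \<open>w\<close> to the boundary satisfies \<open>V w = W\<^sup>2\<close>. Hence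
  \<open>V(|u|\<^sup>p (W\<^sup>2 + \<epsilon>)\<^sup>q w\<^sup>1\<^sup>-\<^sup>p)\<close> with \<open>q = (p - 2)/2\<close> has integral 0; letting \<open>\<epsilon> \<rightarrow> 0\<close> and applying
  Young's inequality pointwise, with \<open>|V u| \<le> W |\<nabla>\<^sub>H u|\<close>, gives the Hardy inequality. The
  \<open>\<epsilon>\<close> is there because \<open>W\<^sup>p\<^sup>-\<^sup>2\<close> need not be differentiable at the zeros of \<open>W\<close>.

  For the sharpness take the half-space \<open>t > 0\<close> and, with \<open>c = (p - 1)/p\<close>,
  \<open>u = t\<^sup>c \<beta>(ln t / N) \<psi>(x, y)\<close>, where \<open>\<beta>\<close> is a bump supported in \<open>[-2, -1]\<close>. On the support
  \<open>t \<le> 1/N\<close>, so the derivatives of \<open>\<beta>\<close> and \<open>\<psi>\<close> contribute a relative error of order \<open>1/N\<close>, and the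
  substitution \<open>s = ln t / N\<close> turns both sides into \<open>N\<close> times integrals over a fixed cylinder.
\<close>

subsection \<open>Integration against divergence-free fields\<close>

text \<open>The open sets \<open>S\<close> and \<open>- K\<close> cover the space, so continuity on
  each of them glues. This makes products of \<open>u\<close> with powers of the boundary distance,
  which are continuous only inside the half-space, continuous everywhere.\<close>

lemma compact_support_continuous:
  fixes f :: "'a::t2_space \<Rightarrow> 'b::real_normed_vector"
  assumes "continuous_on S f" "open S" "compact K" "K \<subseteq> S" "\<And>x. x \<notin> K \<Longrightarrow> f x = 0"
  shows "continuous_on UNIV f"
proof -
  have "open (- K)" using assms(3) by (simp add: compact_imp_closed open_Compl)
  moreover have "continuous_on (- K) f"
    using assms(5) by (subst continuous_on_cong[OF refl, of _ _ "\<lambda>_. 0"]) auto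
  ultimately have "continuous_on (S \<union> - K) f"
    using assms(1,2) by (intro continuous_on_open_Un) auto
  moreover have "S \<union> - K = UNIV" using assms(4) by auto
  ultimately show ?thesis by simp
qed

lemma compact_support_integrable:
  fixes f :: "'a::euclidean_space \<Rightarrow> real"
  assumes "continuous_on UNIV f" "compact K" "\<And>x. x \<notin> K \<Longrightarrow> f x = 0"
  shows "integrable lborel f"
proof -
  have "integrable lborel (\<lambda>x. indicator K x *\<^sub>R f x)"
    using assms(1,2) by (intro borel_integrable_compact) (auto intro: continuous_on_subset)
  moreover have "(\<lambda>x. indicator K x *\<^sub>R f x) = f"
    using assms(3) by (auto simp: indicator_def fun_eq_iff)
  ultimately show ?thesis by simp
qed

lemma compact_support_bounded:
  fixes f :: "'a::euclidean_space \<Rightarrow> real"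
  assumes "continuous_on UNIV f" "compact K" "\<And>x. x \<notin> K \<Longrightarrow> f x = 0"
  obtains M where "\<And>x. \<bar>f x\<bar> \<le> M"
proof -
  have "compact (f ` K)"
    using assms(1,2) by (intro compact_continuous_image) (auto intro: continuous_on_subset)
  then have "\<exists>M. \<forall>x\<in>K. \<bar>f x\<bar> \<le> M"
    by (auto dest!: compact_imp_bounded simp: bounded_iff)
  then obtain M where M: "\<And>x. x \<in> K \<Longrightarrow> \<bar>f x\<bar> \<le> M" by blast
  have "\<bar>f x\<bar> \<le> \<bar>M\<bar>" for x using M[of x] assms(3)[of x] by (cases "x \<in> K") auto
  then show thesis by (rule that)
qed

text \<open>The difference quotients of \<open>f\<close> have integral 0 by translation invariance.\<close>

lemma integral_directional_derivative:
  fixes f g :: "'a::euclidean_space \<Rightarrow> real"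
  assumes deriv: "\<And>x. ((\<lambda>s. f (x + s *\<^sub>R v)) has_real_derivative g x) (at 0)"
    and f: "continuous_on UNIV f" and g: "continuous_on UNIV g"
    and K: "compact K" and f0: "\<And>x. x \<notin> K \<Longrightarrow> f x = 0"
  shows "integral\<^sup>L lborel g = 0"
proof -
  \<comment> \<open>A point outside the closed set \<open>K\<close> stays outside under small
    shifts, so \<open>f\<close> vanishes along the line near it.\<close>
  have g0: "g x = 0" if "x \<notin> K" for x
  proof -
    have "open (- K)" using K by (simp add: compact_imp_closed open_Compl)
    moreover have "isCont (\<lambda>s::real. x + s *\<^sub>R v) 0" by (intro continuous_intros)
    ultimately have "\<forall>\<^sub>F s in nhds 0. x + s *\<^sub>R v \<in> - K"
      using that by (auto simp: isCont_def tendsto_def eventually_nhds_conv_at)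
    then have "\<forall>\<^sub>F s in nhds 0. f (x + s *\<^sub>R v) = 0"
      by (rule eventually_mono) (auto simp: f0)
    then have "((\<lambda>s. f (x + s *\<^sub>R v)) has_real_derivative 0) (at 0)"
      by (subst DERIV_cong_ev[OF refl, of _ "\<lambda>_. 0"]) (auto elim: eventually_mono)
    then show ?thesis using deriv[of x] DERIV_unique by blast
  qed
  have deriv': "((\<lambda>s. f (x + s *\<^sub>R v)) has_real_derivative g (x + s *\<^sub>R v)) (at s)" for x s
  proof -
    have "((\<lambda>r. f ((x + s *\<^sub>R v) + (r - s) *\<^sub>R v)) has_real_derivative g (x + s *\<^sub>R v) * 1) (at s)"
      using deriv[of "x + s *\<^sub>R v"]
      by (intro DERIV_chain2[where f = "\<lambda>r. f ((x + s *\<^sub>R v) + r *\<^sub>R v)"])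
        (auto intro!: derivative_eq_intros)
    then show ?thesis by (simp add: algebra_simps)
  qed
  obtain M where M: "\<bar>g x\<bar> \<le> M" for x
    using compact_support_bounded[OF g K g0] by blast
  define h where "h k = 1 / real (Suc k)" for k
  have h: "h k > 0" "h k \<le> 1" for k by (auto simp: h_def)
  define D where "D k x = (f (x + h k *\<^sub>R v) - f x) / h k" for k x
  \<comment> \<open>All shifts of \<open>K\<close> by \<open>- s *\<^sub>R v\<close> with
    \<open>s\<close> in \<open>[0, 1]\<close>. Since \<open>h k \<le> 1\<close>, this one compact
    set contains the support of every difference quotient \<open>D k\<close>.\<close>
  define L where "L = (\<lambda>(x, s). x - s *\<^sub>R v) ` (K \<times> {0..1::real})"
  have L: "compact L"
    unfolding L_def case_prod_beta using K
    by (intro compact_continuous_image continuous_intros compact_Times) auto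
  have fint: "integrable lborel f" using compact_support_integrable[OF f K f0] .
  have distr: "distr lborel borel (\<lambda>x. x + w) = lborel" for w :: 'a
    using lborel_distr_plus[of w] by (subst add.commute) simp
  have fint': "integrable lborel (\<lambda>x. f (x + w))" for w
    using fint integrable_distr_eq[of "\<lambda>x. x + w" lborel borel f]
      borel_measurable_continuous_onI[OF f] by (simp add: distr)
  have fshift: "(\<integral>x. f (x + w) \<partial>lborel) = integral\<^sup>L lborel f" for w
    using integral_distr[of "\<lambda>x. x + w" lborel borel f]
      borel_measurable_continuous_onI[OF f] by (simp add: distr)
  have D0: "integral\<^sup>L lborel (D k) = 0" for k
    unfolding D_def using fint fint' fshift by simp
  have meas: "g \<in> borel_measurable lborel" "D k \<in> borel_measurable lborel" for k
    unfolding D_def using borel_measurable_continuous_onI[OF g] borel_measurable_continuous_onI[OF f]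
    by measurable
  \<comment> \<open>By the mean value theorem each difference quotient is a value of
    \<open>g\<close>, so the bound of \<open>g\<close> on \<open>L\<close> dominates all of
    them.\<close>
  have bound: "\<bar>D k x\<bar> \<le> M * indicator L x" for k x
  proof (cases "x \<in> L")
    case True
    have "\<exists>z>0. z < h k \<and> f (x + h k *\<^sub>R v) - f (x + 0 *\<^sub>R v) = (h k - 0) * g (x + z *\<^sub>R v)"
      using h by (intro MVT2) (auto intro: deriv')
    then obtain z where "f (x + h k *\<^sub>R v) - f x = h k * g (x + z *\<^sub>R v)" by auto
    then have "D k x = g (x + z *\<^sub>R v)" using h[of k] by (simp add: D_def)
    then show ?thesis using True M by simp
  next
    case False
    have "x + s *\<^sub>R v \<notin> K" if "s \<in> {0..1}" for s
    proof
      assume "x + s *\<^sub>R v \<in> K"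
      then have "(\<lambda>(x, s). x - s *\<^sub>R v) (x + s *\<^sub>R v, s) \<in> L"
        unfolding L_def using that by (intro imageI) auto
      then show False using False by simp
    qed
    from this[of 0] this[of "h k"] h[of k] show ?thesis
      using False by (simp add: D_def f0)
  qed
  have "(\<lambda>k. integral\<^sup>L lborel (D k)) \<longlonglongrightarrow> integral\<^sup>L lborel g"
  proof (rule integral_dominated_convergence)
    show "integrable lborel (\<lambda>x. M * indicator L x)"
      using borel_integrable_compact[OF L, of "\<lambda>_. M"] by (simp add: mult.commute)
    show "AE x in lborel. (\<lambda>k. D k x) \<longlonglongrightarrow> g x"
    proof (intro AE_I2)
      fix x
      have "((\<lambda>s. (f (x + s *\<^sub>R v) - f x) / s) \<longlongrightarrow> g x) (at 0)"
        using deriv[of x] by (simp add: DERIV_def)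
      moreover have "filterlim h (at 0) sequentially"
        unfolding filterlim_at using LIMSEQ_Suc[OF lim_1_over_n] h
        by (auto simp: h_def[abs_def])
      ultimately show "(\<lambda>k. D k x) \<longlonglongrightarrow> g x"
        unfolding D_def by (rule filterlim_compose)
    qed
  qed (use meas bound in auto)
  then show ?thesis using D0 by (simp add: LIMSEQ_const_iff)
qed

text \<open>Divergence-freeness of \<open>V\<close> enters in the form that each component of \<open>V\<close> is constant along
  its own coordinate direction.\<close>

lemma integral_divergence_free:
  fixes f :: "'a::euclidean_space \<Rightarrow> real"
  assumes deriv: "\<And>x. (f has_derivative f' x) (at x)"
    and cont: "\<And>b. b \<in> Basis \<Longrightarrow> continuous_on UNIV (\<lambda>x. f' x b)"
    and V: "continuous_on UNIV V"
    and inv: "\<And>b x s. b \<in> Basis \<Longrightarrow> V (x + s *\<^sub>R b) \<bullet> b = V x \<bullet> b"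
    and K: "compact K" and f0: "\<And>x. x \<notin> K \<Longrightarrow> f x = 0"
  shows "integral\<^sup>L lborel (\<lambda>x. f' x (V x)) = 0"
proof -
  have contf: "continuous_on UNIV f"
    using deriv by (meson UNIV_I continuous_at_imp_continuous_on has_derivative_continuous)
  have f'0: "f' x = (\<lambda>_. 0)" if "x \<notin> K" for x
  proof -
    have "(f has_derivative (\<lambda>_. 0)) (at x)"
      by (rule has_derivative_transform_within_open[OF has_derivative_const, of "- K"])
        (use that f0 K in \<open>auto simp: compact_imp_closed open_Compl\<close>)
    then show ?thesis using deriv has_derivative_unique by blast
  qed
  let ?g = "\<lambda>b x. f' x b * (V x \<bullet> b)"
  have gc: "continuous_on UNIV (?g b)" if "b \<in> Basis" for b
    using cont[OF that] V by (intro continuous_intros)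
  have int: "integral\<^sup>L lborel (?g b) = 0" if b: "b \<in> Basis" for b
  proof (rule integral_directional_derivative[where f = "\<lambda>x. f x * (V x \<bullet> b)" and v = b])
    fix x
    have "((\<lambda>s. f (x + s *\<^sub>R b)) has_derivative (\<lambda>s. f' x (s *\<^sub>R b))) (at 0)"
      by (rule has_derivative_compose[where f = "\<lambda>s. x + s *\<^sub>R b" and g = f])
        (auto intro!: derivative_eq_intros simp: deriv)
    moreover have "f' x (s *\<^sub>R b) = f' x b * s" for s
      using linear_scale[OF has_derivative_linear[OF deriv[of x]], of s b] by simp
    ultimately have "((\<lambda>s. f (x + s *\<^sub>R b)) has_real_derivative f' x b) (at 0)"
      by (simp add: has_field_derivative_def)
    \<comment> \<open>Along \<open>b\<close> the component \<open>V x \<bullet> b\<close> is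
      constant, so the product rule yields no term with a derivative of \<open>V\<close>.\<close>
    then show "((\<lambda>s. f (x + s *\<^sub>R b) * (V (x + s *\<^sub>R b) \<bullet> b)) has_real_derivative ?g b x) (at 0)"
      unfolding inv[OF b] by (rule DERIV_cmult_right)
  qed (use contf V gc[OF b] K f0 in \<open>auto intro!: continuous_intros\<close>)
  have "f' x (V x) = (\<Sum>b\<in>Basis. ?g b x)" for x
  proof -
    have lin: "linear (f' x)" using deriv has_derivative_linear by blast
    have "f' x (V x) = f' x (\<Sum>b\<in>Basis. (V x \<bullet> b) *\<^sub>R b)" by (simp add: euclidean_representation)
    then show ?thesis by (simp add: linear_sum[OF lin] linear_scale[OF lin] mult.commute)
  qed
  then have "integral\<^sup>L lborel (\<lambda>x. f' x (V x)) = (\<Sum>b\<in>Basis. integral\<^sup>L lborel (?g b))"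
    using gc K f'0 by (simp, intro Bochner_Integration.integral_sum)
      (auto intro!: compact_support_integrable[where K = K])
  then show ?thesis using int by simp
qed

text \<open>Expand \<open>v x\<close> in the basis: the value is a finite sum of products of
  continuous functions. It passes from fixed directions to derivatives along the variable fields
  \<open>X_field\<close>, \<open>Y_field\<close> and \<open>normal_field\<close>.\<close>

lemma continuous_on_linear_family:
  fixes L :: "'a::topological_space \<Rightarrow> 'b::euclidean_space \<Rightarrow> real"
  assumes "\<And>x. linear (L x)" "\<And>b. b \<in> Basis \<Longrightarrow> continuous_on S (\<lambda>x. L x b)" "continuous_on S v"
  shows "continuous_on S (\<lambda>x. L x (v x))"
proof -
  have "L x (v x) = (\<Sum>b\<in>Basis. (v x \<bullet> b) * L x b)" for x
  proof -
    have "L x (v x) = L x (\<Sum>b\<in>Basis. (v x \<bullet> b) *\<^sub>R b)" by (simp add: euclidean_representation)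
    then show ?thesis by (simp add: linear_sum[OF assms(1)] linear_scale[OF assms(1)])
  qed
  then show ?thesis using assms(2,3) by (simp, intro continuous_intros) auto
qed

text \<open>Away from 0 this is the power rule on either side. At 0 the difference quotient has
  absolute value \<open>\<bar>h\<bar> powr (p - 1)\<close>, which tends to 0 because
  \<open>p > 1\<close>.\<close>

lemma has_real_derivative_abs_powr:
  fixes p :: real
  assumes "p > 1"
  shows "((\<lambda>s. \<bar>s\<bar> powr p) has_real_derivative p * sgn s * \<bar>s\<bar> powr (p - 1)) (at s)"
proof (cases "s = 0")
  case True
  have "((\<lambda>h::real. \<bar>h\<bar> powr (p - 1)) \<longlongrightarrow> 0) (at 0)"
    using assms by (auto intro!: tendsto_eq_intros)
  then have "((\<lambda>h. \<bar>\<bar>h\<bar> powr p / h\<bar>) \<longlongrightarrow> 0) (at 0)"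
    by (rule Lim_transform_eventually)
      (auto simp: eventually_at powr_diff abs_divide intro!: exI[of _ 1])
  then have "((\<lambda>h. \<bar>h\<bar> powr p / h) \<longlongrightarrow> 0) (at 0)" by (rule tendsto_rabs_zero_cancel)
  then show ?thesis using True by (simp add: DERIV_def)
next
  case False
  then consider "s > 0" | "s < 0" by linarith
  then show ?thesis
  proof cases
    case 1
    have "((\<lambda>s. s powr p) has_real_derivative p * s powr (p - 1)) (at s)"
      using 1 by (rule has_real_derivative_powr)
    moreover have "\<forall>\<^sub>F r in nhds s. \<bar>r\<bar> powr p = r powr p"
      using eventually_nhds_in_open[of "{0<..}" s] 1 by (auto elim!: eventually_mono)
    ultimately show ?thesis using 1 by (subst DERIV_cong_ev[OF refl]) auto
  next
    case 2
    have "((\<lambda>s. (- s) powr p) has_real_derivative p * (- s) powr (p - 1) * (- 1)) (at s)"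
      using 2 by (auto intro!: derivative_eq_intros simp: powr_diff)
    moreover have "\<forall>\<^sub>F r in nhds s. \<bar>r\<bar> powr p = (- r) powr p"
      using eventually_nhds_in_open[of "{..<0}" s] 2 by (auto elim!: eventually_mono)
    ultimately show ?thesis using 2 by (subst DERIV_cong_ev[OF refl]) auto
  qed
qed

subsection \<open>The Hardy inequality\<close>

text \<open>The vector of all inner products of the fields with \<open>\<nu>\<close>, that is, the
  horizontal gradient of the boundary distance. Its Euclidean norm is the angle function.\<close>

definition horizontal_normal :: "'n::finite heisenberg \<Rightarrow> 'n heisenberg \<Rightarrow> (real ^ 'n) \<times> (real ^ 'n)" where
  "horizontal_normal \<nu> = (\<lambda>(x, y, t). (fst \<nu> + (2 * snd (snd \<nu>)) *\<^sub>R y, fst (snd \<nu>) - (2 * snd (snd \<nu>)) *\<^sub>R x))"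

text \<open>The vector field \<open>\<Sum>\<^sub>i \<langle>X\<^sub>i, \<nu>\<rangle> X\<^sub>i + \<langle>Y\<^sub>i, \<nu>\<rangle> Y\<^sub>i\<close>.\<close>

definition normal_field :: "'n::finite heisenberg \<Rightarrow> 'n heisenberg \<Rightarrow> 'n heisenberg" where
  "normal_field \<nu> \<xi> = (case (horizontal_normal \<nu> \<xi>, \<xi>) of
     ((a, b), (x, y, t)) \<Rightarrow> (a, b, 2 * (y \<bullet> a) - 2 * (x \<bullet> b)))"

lemma angle_function_eq_norm: "angle_function \<nu> \<xi> = norm (horizontal_normal \<nu> \<xi>)"
proof (cases \<nu>, cases \<xi>)
  fix a b c x y t assume "\<nu> = (a, b, c)" "\<xi> = (x, y, t)"
  then show ?thesis
    by (simp add: angle_function_def horizontal_normal_def inner_X_field inner_Y_field norm_prod_def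
        norm_vec_def L2_set_def sum.distrib sum_nonneg algebra_simps)
qed

lemma angle_function_sq: "(angle_function \<nu> \<xi>)\<^sup>2 = horizontal_normal \<nu> \<xi> \<bullet> horizontal_normal \<nu> \<xi>"
  by (simp add: angle_function_eq_norm dot_square_norm)

lemma inner_normal_field: "normal_field \<nu> \<xi> \<bullet> \<nu> = (angle_function \<nu> \<xi>)\<^sup>2"
proof (cases \<nu>, cases \<xi>)
  fix a b c x y t assume "\<nu> = (a, b, c)" "\<xi> = (x, y, t)"
  then show ?thesis
    by (simp add: angle_function_sq normal_field_def horizontal_normal_def algebra_simps
        inner_commute)
qed

text \<open>For \<open>L\<close> the derivative of \<open>u\<close>, the derivative along the normal
  field becomes an inner product with the horizontal gradient of \<open>u\<close>, ready for
  Cauchy-Schwarz.\<close>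

lemma linear_normal_field:
  assumes "linear (L :: 'n::finite heisenberg \<Rightarrow> real)"
  shows "L (normal_field \<nu> \<xi>) = horizontal_normal \<nu> \<xi> \<bullet>
    ((\<chi> i. L (X_field i \<xi>)), (\<chi> i. L (Y_field i \<xi>)))"
proof (cases "horizontal_normal \<nu> \<xi>", cases \<xi>)
  fix a b x y t assume *: "horizontal_normal \<nu> \<xi> = (a, b)" "\<xi> = (x, y, t)"
  have "normal_field \<nu> \<xi> = (\<Sum>i\<in>UNIV. (a $ i) *\<^sub>R X_field i \<xi> + (b $ i) *\<^sub>R Y_field i \<xi>)"
    unfolding normal_field_def * *(1)[unfolded *(2)] prod.case
    by (simp add: X_field_def Y_field_def prod_eq_iff fst_sum snd_sum sum.distrib inner_vec_def
        sum_distrib_left vec_eq_iff axis_def mult_ac if_distrib[where f = "(*) c" for c] cong: if_cong)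
      (simp add: sum_subtractf)
  then show ?thesis
    using * by (simp add: linear_sum[OF assms] linear_add[OF assms] linear_scale[OF assms]
        inner_vec_def sum.distrib)
qed

lemma continuous_on_horizontal_normal [continuous_intros]: "continuous_on S (horizontal_normal \<nu>)"
  unfolding horizontal_normal_def case_prod_beta by (intro continuous_intros)

lemma continuous_on_normal_field: "continuous_on S (normal_field \<nu>)"
  unfolding normal_field_def case_prod_beta
  by (simp add: case_prod_beta) (intro continuous_intros)

lemma continuous_on_angle_function [continuous_intros]: "continuous_on S (angle_function \<nu>)"
  unfolding angle_function_eq_norm[abs_def] by (intro continuous_intros)

lemma continuous_on_boundary_dist [continuous_intros]: "continuous_on S (boundary_dist \<nu> d)"
  unfolding boundary_dist_def[abs_def] by (intro continuous_intros)

lemma open_half_space: "open (half_space \<nu> d)"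
  using open_halfspace_gt[of d \<nu>] by (simp add: half_space_def inner_commute)

text \<open>The \<open>x\<close>-part of the field depends on \<open>y\<close> only, the
  \<open>y\<close>-part on \<open>x\<close> only, and the \<open>t\<close>-part does not depend on
  \<open>t\<close>.\<close>

lemma normal_field_component_invariant:
  assumes "b \<in> Basis"
  shows "normal_field \<nu> (\<xi> + s *\<^sub>R b) \<bullet> b = normal_field \<nu> \<xi> \<bullet> b"
  using assms unfolding Basis_prod_def
  by (cases \<xi>, cases \<nu>) (auto simp: normal_field_def horizontal_normal_def inner_Basis)

text \<open>If \<open>(a, b)\<close> is the horizontal normal, its derivative along the normal field
  is a multiple of \<open>(b, - a)\<close>, hence orthogonal to \<open>(a, b)\<close>. The square is
  differentiated because the norm need not be differentiable where it vanishes.\<close>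

lemma angle_function_sq_has_derivative:
  obtains D where "\<And>\<xi>. ((\<lambda>\<xi>. (angle_function \<nu> \<xi>)\<^sup>2) has_derivative D \<xi>) (at \<xi>)"
    "\<And>h. continuous_on UNIV (\<lambda>\<xi>. D \<xi> h)" "\<And>\<xi>. D \<xi> (normal_field \<nu> \<xi>) = 0"
proof
  define N where "N h = ((2 * snd (snd \<nu>)) *\<^sub>R fst (snd h), - (2 * snd (snd \<nu>)) *\<^sub>R fst h)"
    for h :: "'a heisenberg"
  have N: "(horizontal_normal \<nu> has_derivative N) (at \<xi>)" for \<xi>
    unfolding horizontal_normal_def N_def case_prod_beta by (auto intro!: derivative_eq_intros)
  show "((\<lambda>\<xi>. (angle_function \<nu> \<xi>)\<^sup>2) has_derivative (\<lambda>h. 2 * (horizontal_normal \<nu> \<xi> \<bullet> N h))) (at \<xi>)"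
    for \<xi>
    unfolding angle_function_sq by (auto intro!: derivative_eq_intros N simp: inner_commute)
  show "continuous_on UNIV (\<lambda>\<xi>. 2 * (horizontal_normal \<nu> \<xi> \<bullet> N h))" for h
    by (intro continuous_intros)
  show "2 * (horizontal_normal \<nu> \<xi> \<bullet> N (normal_field \<nu> \<xi>)) = 0" for \<xi>
    by (cases \<xi>, cases \<nu>) (auto simp: N_def normal_field_def horizontal_normal_def algebra_simps inner_commute)
qed

lemma test_functionsD:
  assumes "u \<in> test_functions S"
  shows "(u has_derivative frechet_derivative u (at x)) (at x)"
    and "continuous_on UNIV u"
    and "continuous_on UNIV (\<lambda>x. frechet_derivative u (at x) v)"
    and "compact (closure {x. u x \<noteq> 0})" "closure {x. u x \<noteq> 0} \<subseteq> S"
    and "\<And>x. x \<notin> closure {x. u x \<noteq> 0} \<Longrightarrow> u x = 0"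
proof -
  have "C_k 0 u" "C_k (Suc 0) u" using assms by (auto simp: test_functions_def simp del: C_k.simps)
  then show "(u has_derivative frechet_derivative u (at x)) (at x)" "continuous_on UNIV u"
    "continuous_on UNIV (\<lambda>x. frechet_derivative u (at x) v)"
    by (auto simp: frechet_derivative_works[symmetric])
  show "\<And>x. x \<notin> closure {x. u x \<noteq> 0} \<Longrightarrow> u x = 0"
    using closure_subset[of "{x. u x \<noteq> 0}"] by blast
qed (use assms in \<open>auto simp: test_functions_def\<close>)

lemma frechet_derivative_zero_outside:
  assumes "u \<in> test_functions S" "x \<notin> closure {x. u x \<noteq> 0}"
  shows "frechet_derivative u (at x) = (\<lambda>_. 0)"
proof -
  have "(u has_derivative (\<lambda>_. 0)) (at x)"
  proof (rule has_derivative_transform_within_open[OF has_derivative_const])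
    show "open (- closure {x. u x \<noteq> 0})" by (simp add: open_Compl)
    show "x \<in> - closure {x. u x \<noteq> 0}" using assms(2) by simp
    show "0 = u y" if "y \<in> - closure {x. u x \<noteq> 0}" for y
      using test_functionsD(6)[OF assms(1), of y] that by (metis ComplD)
  qed
  then show ?thesis using test_functionsD(1)[OF assms(1)] has_derivative_unique by blast
qed

lemma continuous_on_horizontal_gradient:
  assumes "u \<in> test_functions S"
  shows "continuous_on A (horizontal_gradient u)"
proof -
  have lin: "linear (frechet_derivative u (at x))" for x
    using test_functionsD(1)[OF assms] has_derivative_linear by blast
  have D: "continuous_on UNIV (\<lambda>x. frechet_derivative u (at x) b)" for b
    by (rule test_functionsD(3)[OF assms])
  have XY: "continuous_on UNIV (X_field i)" "continuous_on UNIV (Y_field i)" for i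
    unfolding X_field_def Y_field_def case_prod_beta by (intro continuous_intros)+
  have "continuous_on UNIV (horizontal_gradient u)"
    unfolding horizontal_gradient_def
    by (rule continuous_on_Pair; rule continuous_on_vec_lambda;
        rule continuous_on_linear_family[OF lin D]; rule XY)
  then show ?thesis by (rule continuous_on_subset) simp
qed

text \<open>Young's inequality in the form that is an equality for \<open>b = ((p - 1) / p) a\<close>.\<close>

lemma Young_hardy:
  fixes a b p :: real
  assumes "p > 1" "a \<ge> 0" "b \<ge> 0"
  defines "c \<equiv> (p - 1) / p"
  shows "c powr (p - 1) * (p * a powr (p - 1) * b - (p - 1) * a powr p) \<le> b powr p - c powr p * a powr p"
proof -
  have c: "c > 0" using assms by simp
  define q where "q = p / (p - 1)"
  have q: "q > 0" "1 / q + 1 / p = 1" "(p - 1) * q = p" using assms by (auto simp: q_def field_simps)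
  have cq: "1 / q = c" using assms by (simp add: q_def c_def)
  have cp: "c powr (p - 1) * (p - 1) = p * c powr p"
    using assms c by (simp add: powr_diff c_def)
  \<comment> \<open>The conjugate exponents are \<open>q = p / (p - 1)\<close> and \<open>p\<close>;
    scaling \<open>a\<close> by \<open>c\<close> places the equality case at
    \<open>b = c * a\<close>.\<close>
  have "(c * a) powr (p - 1) * b \<le> ((c * a) powr (p - 1)) powr q / q + b powr p / p"
    using assms q by (intro Youngs_inequality) (auto simp: q_def)
  also have "\<dots> = c * (c * a) powr p + b powr p / p"
    by (simp only: powr_powr q(3) cq[symmetric]) simp
  finally have "p * ((c * a) powr (p - 1) * b) \<le> p * (c * (c * a) powr p + b powr p / p)"
    using assms by (intro mult_left_mono) auto
  moreover have "p * (c * (c * a) powr p + b powr p / p) = (p - 1) * (c * a) powr p + b powr p"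
    using assms by (simp add: c_def field_simps)
  ultimately have "p * ((c * a) powr (p - 1) * b) \<le> (p - 1) * (c * a) powr p + b powr p" by simp
  \<comment> \<open>The powers are abstracted to plain variables, so that only a rearrangement of
    sums and products remains.\<close>
  moreover have "c1 * (p * a1 * b - (p - 1) * ap) \<le> bp - cp * ap"
    if "p * (c1 * a1 * b) \<le> (p - 1) * (cp * ap) + bp" "c1 * ((p - 1) * ap) = p * (cp * ap)"
    for c1 a1 ap bp cp :: real
    using that by (simp add: algebra_simps)
  moreover have "c powr (p - 1) * ((p - 1) * a powr p) = p * (c powr p * a powr p)"
    by (simp only: mult.assoc[symmetric] cp)
  ultimately show ?thesis unfolding powr_mult by blast
qed

text \<open>The jump of the sign at 0 is absorbed by the power, which tends to 0 there. With
  \<open>a = p - 1\<close> this is the derivative of \<open>\<bar>s\<bar> powr p\<close> up to the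
  factor \<open>p\<close>.\<close>

lemma continuous_on_sgn_abs_powr:
  fixes f :: "'a::topological_space \<Rightarrow> real"
  assumes "a > 0" "continuous_on S f"
  shows "continuous_on S (\<lambda>x. sgn (f x) * \<bar>f x\<bar> powr a)"
proof -
  have "isCont (\<lambda>s::real. sgn s * \<bar>s\<bar> powr a) s" for s
  proof (cases "s = 0")
    case True
    have "((\<lambda>s::real. \<bar>s\<bar> powr a) \<longlongrightarrow> 0) (at 0)"
      using assms(1) by (auto intro!: tendsto_eq_intros)
    moreover have "\<bar>sgn s * \<bar>s\<bar> powr a\<bar> = \<bar>s\<bar> powr a" for s :: real
      by (simp add: abs_mult sgn_if)
    ultimately have "((\<lambda>s::real. \<bar>sgn s * \<bar>s\<bar> powr a\<bar>) \<longlongrightarrow> 0) (at 0)" by simp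
    then show ?thesis using True by (simp add: isCont_def tendsto_rabs_zero_cancel)
  qed (auto intro!: continuous_intros)
  then have "continuous_on UNIV (\<lambda>s::real. sgn s * \<bar>s\<bar> powr a)"
    by (simp add: continuous_at_imp_continuous_on)
  then show ?thesis by (rule continuous_on_compose2) (use assms(2) in auto)
qed

lemma hardy_half_space:
  fixes \<nu> :: "'n::finite heisenberg"
  assumes p: "p > 1" and u: "u \<in> test_functions (half_space \<nu> d)"
  shows "((p - 1) / p) powr p *
      (LINT \<xi>:half_space \<nu> d|lborel. angle_function \<nu> \<xi> powr p / boundary_dist \<nu> d \<xi> powr p * \<bar>u \<xi>\<bar> powr p)
    \<le> (LINT \<xi>:half_space \<nu> d|lborel. norm (horizontal_gradient u \<xi>) powr p)"
proof -
  define H where "H = half_space \<nu> d"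
  define K where "K = closure {\<xi>. u \<xi> \<noteq> 0}"
  define w where "w = boundary_dist \<nu> d"
  define W where "W = angle_function \<nu>"
  define Du where "Du \<xi> = frechet_derivative u (at \<xi>)" for \<xi>
  define B where "B \<xi> = norm (horizontal_gradient u \<xi>)" for \<xi>
  define V where "V = normal_field \<nu>"
  define q where "q = (p - 2) / 2"
  define c where "c = (p - 1) / p"
  note Du = test_functionsD(1)[OF u, folded Du_def]
  note u_cont = continuous_on_subset[OF test_functionsD(2)[OF u] subset_UNIV]
  note Du_cont = continuous_on_subset[OF test_functionsD(3)[OF u, folded Du_def] subset_UNIV]
  have K: "compact K" "K \<subseteq> H" "\<And>\<xi>. \<xi> \<notin> K \<Longrightarrow> u \<xi> = 0"
    using test_functionsD(4,5)[OF u] by (auto simp: K_def H_def intro: test_functionsD(6)[OF u])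
  have H: "open H" by (simp add: H_def open_half_space)
  have w: "w \<xi> > 0" if "\<xi> \<in> H" for \<xi>
    using that by (simp add: w_def H_def half_space_def boundary_dist_def)
  have W: "W \<xi> \<ge> 0" for \<xi> by (simp add: W_def angle_function_eq_norm)
  have w_cont: "continuous_on S w" and W_cont: "continuous_on S W" and B_cont: "continuous_on S B" for S
    unfolding w_def W_def B_def by (intro continuous_intros continuous_on_horizontal_gradient[OF u])+
  obtain D where D: "\<And>\<xi>. ((\<lambda>\<xi>. (W \<xi>)\<^sup>2) has_derivative D \<xi>) (at \<xi>)"
    "\<And>h. continuous_on UNIV (\<lambda>\<xi>. D \<xi> h)" "\<And>\<xi>. D \<xi> (V \<xi>) = 0"
    unfolding W_def V_def using angle_function_sq_has_derivative by blast
  note D_cont = continuous_on_subset[OF D(2) subset_UNIV]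
  have wp_cont: "continuous_on H (\<lambda>\<xi>. w \<xi> powr r)" for r
    using w by (intro continuous_on_powr w_cont continuous_on_const) (auto simp: less_imp_neq[symmetric])
  have Wp_cont: "continuous_on S (\<lambda>\<xi>. ((W \<xi>)\<^sup>2 + \<epsilon>) powr r)" if "\<epsilon> > 0" for S \<epsilon> r
  proof (intro continuous_on_powr continuous_intros W_cont ballI)
    show "(W \<xi>)\<^sup>2 + \<epsilon> \<noteq> 0" for \<xi> using that by (smt (verit) zero_le_power2)
  qed
  have up_cont: "continuous_on S (\<lambda>\<xi>. \<bar>u \<xi>\<bar> powr r)" if "r > 0" for S r
    using that by (intro continuous_on_powr' continuous_on_rabs u_cont continuous_on_const) auto
  have V\<nu>: "V \<xi> \<bullet> \<nu> = (W \<xi>)\<^sup>2" for \<xi> by (simp add: V_def W_def inner_normal_field)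
  have DuV: "\<bar>Du \<xi> (V \<xi>)\<bar> \<le> W \<xi> * B \<xi>" for \<xi>
    unfolding V_def linear_normal_field[OF has_derivative_linear[OF Du]]
    unfolding W_def B_def angle_function_eq_norm horizontal_gradient_def Du_def
    by (rule Cauchy_Schwarz_ineq2)
  have B0: "B \<xi> = 0" if "\<xi> \<notin> K" for \<xi>
    using frechet_derivative_zero_outside[OF u that[unfolded K_def]]
    by (simp add: B_def horizontal_gradient_def zero_vec_def[symmetric])

  \<comment> \<open>For \<open>\<epsilon> > 0\<close> this is the derivative along \<open>V\<close>
    of the product regularised by \<open>\<epsilon>\<close>. The power of
    \<open>(W \<xi>)\<^sup>2 + \<epsilon>\<close> contributes no term, as \<open>V\<close> preserves
    \<open>W\<close>; the separate factor \<open>(W \<xi>)\<^sup>2\<close> is the derivative of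
    \<open>w\<close> along \<open>V\<close>.\<close>
  define F where "F \<epsilon> \<xi> = p * (sgn (u \<xi>) * \<bar>u \<xi>\<bar> powr (p - 1)) * Du \<xi> (V \<xi>) * ((W \<xi>)\<^sup>2 + \<epsilon>) powr q * w \<xi> powr (1 - p)
      - (p - 1) * \<bar>u \<xi>\<bar> powr p * ((W \<xi>)\<^sup>2 + \<epsilon>) powr q * (W \<xi>)\<^sup>2 * w \<xi> powr (- p)" for \<epsilon> \<xi>

  have F_int: "integral\<^sup>L lborel (F \<epsilon>) = 0" and F_meas: "F \<epsilon> \<in> borel_measurable borel" if \<epsilon>: "\<epsilon> > 0" for \<epsilon>
  proof -
    let ?m = "\<lambda>\<xi>. ((W \<xi>)\<^sup>2 + \<epsilon>) powr q"
    have Wpos: "(W \<xi>)\<^sup>2 + \<epsilon> > 0" for \<xi> using \<epsilon> by (intro add_nonneg_pos) auto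
    define \<phi> where "\<phi> \<xi> = \<bar>u \<xi>\<bar> powr p * (?m \<xi> * w \<xi> powr (1 - p))" for \<xi>
    define \<phi>' where "\<phi>' \<xi> h = p * (sgn (u \<xi>) * \<bar>u \<xi>\<bar> powr (p - 1)) * Du \<xi> h * (?m \<xi> * w \<xi> powr (1 - p))
      + \<bar>u \<xi>\<bar> powr p * (q * ((W \<xi>)\<^sup>2 + \<epsilon>) powr (q - 1) * D \<xi> h * w \<xi> powr (1 - p)
         + ?m \<xi> * ((1 - p) * w \<xi> powr (- p) * (h \<bullet> \<nu>)))" for \<xi> h
    have \<phi>0: "\<phi> \<xi> = 0" "\<phi>' \<xi> h = 0" if "\<xi> \<notin> K" for \<xi> h
      using K(3)[OF that] by (simp_all add: \<phi>_def \<phi>'_def)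
    have deriv: "(\<phi> has_derivative \<phi>' \<xi>) (at \<xi>)" for \<xi>
    proof (cases "\<xi> \<in> H")
      case True
      have up: "((\<lambda>\<xi>. \<bar>u \<xi>\<bar> powr p) has_derivative
          (\<lambda>h. p * (sgn (u \<xi>) * \<bar>u \<xi>\<bar> powr (p - 1)) * Du \<xi> h)) (at \<xi>)"
        using has_derivative_compose[OF Du has_real_derivative_abs_powr[OF p, unfolded has_field_derivative_def]]
        by (simp add: mult_ac)
      have m: "(?m has_derivative (\<lambda>h. q * ((W \<xi>)\<^sup>2 + \<epsilon>) powr (q - 1) * D \<xi> h)) (at \<xi>)"
        using has_derivative_compose[OF has_derivative_add[OF D(1) has_derivative_const]
            has_real_derivative_powr[OF Wpos, unfolded has_field_derivative_def]]
        by simp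
      have "(w has_derivative (\<lambda>h. h \<bullet> \<nu>)) (at \<xi>)"
        unfolding w_def boundary_dist_def[abs_def] by (auto intro!: derivative_eq_intros)
      from has_derivative_compose[OF this
          has_real_derivative_powr[OF w[OF True], of "1 - p", unfolded has_field_derivative_def]]
      have wp: "((\<lambda>\<xi>. w \<xi> powr (1 - p)) has_derivative (\<lambda>h. (1 - p) * w \<xi> powr (- p) * (h \<bullet> \<nu>))) (at \<xi>)"
        by simp
      show ?thesis
        unfolding \<phi>_def \<phi>'_def
        by (rule has_derivative_eq_rhs[OF has_derivative_mult[OF up has_derivative_mult[OF m wp]]])
          (auto simp: algebra_simps)
    next
      case False
      \<comment> \<open>A point outside \<open>H\<close> lies in the open complement of
        \<open>K\<close>, where \<open>\<phi>\<close> vanishes identically.\<close>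
      have "(\<phi> has_derivative (\<lambda>_. 0)) (at \<xi>)"
        by (rule has_derivative_transform_within_open[OF has_derivative_const, of "- K"])
          (use False K \<phi>0 in \<open>auto simp: compact_imp_closed open_Compl\<close>)
      moreover have "\<phi>' \<xi> = (\<lambda>_. 0)" using False K(2) \<phi>0 by blast
      ultimately show ?thesis by simp
    qed
    have cont: "continuous_on UNIV (\<lambda>\<xi>. \<phi>' \<xi> h)" for h
    proof (rule compact_support_continuous[OF _ H K(1,2)])
      show "continuous_on H (\<lambda>\<xi>. \<phi>' \<xi> h)"
        unfolding \<phi>'_def using p \<epsilon>
        by (intro continuous_on_add continuous_on_mult continuous_on_const continuous_on_sgn_abs_powr
            u_cont Du_cont D_cont wp_cont Wp_cont up_cont) auto
    qed (simp add: \<phi>0)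
    have "\<phi>' \<xi> (V \<xi>) = F \<epsilon> \<xi>" for \<xi>
      unfolding \<phi>'_def F_def D(3) V\<nu> by (simp add: algebra_simps)
    then have eq: "(\<lambda>\<xi>. \<phi>' \<xi> (V \<xi>)) = F \<epsilon>" by (rule ext)
    have V_cont: "continuous_on UNIV V" unfolding V_def by (rule continuous_on_normal_field)
    have "continuous_on UNIV (\<lambda>\<xi>. \<phi>' \<xi> (V \<xi>))"
      by (rule continuous_on_linear_family[OF has_derivative_linear[OF deriv] cont V_cont])
    then show "F \<epsilon> \<in> borel_measurable borel"
      unfolding eq by (rule borel_measurable_continuous_onI)
    have "integral\<^sup>L lborel (\<lambda>\<xi>. \<phi>' \<xi> (V \<xi>)) = 0"
      by (rule integral_divergence_free[OF deriv cont V_cont _ K(1) \<phi>0(1)])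
        (simp add: V_def normal_field_component_invariant)
    then show "integral\<^sup>L lborel (F \<epsilon>) = 0" unfolding eq .
  qed

  define \<epsilon> where "\<epsilon> k = 1 / real (Suc k)" for k
  have \<epsilon>: "\<epsilon> k > 0" "\<epsilon> k \<le> 1" for k by (auto simp: \<epsilon>_def)
  have \<epsilon>_lim: "\<epsilon> \<longlonglongrightarrow> 0" unfolding \<epsilon>_def using LIMSEQ_Suc[OF lim_1_over_n] by simp
  \<comment> \<open>A bound uniform in \<open>\<epsilon> \<le> 1\<close>. The exponent
    \<open>q\<close> is negative for \<open>p < 2\<close>, but with
    \<open>E = (W \<xi>)\<^sup>2 + \<epsilon>\<close> one has
    \<open>W \<xi> * E powr q \<le> E powr ((p - 1) / 2)\<close> and
    \<open>(W \<xi>)\<^sup>2 * E powr q \<le> E powr (p / 2)\<close>. These exponents are positive,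
    so \<open>\<epsilon>\<close> may be raised to 1.\<close>
  define G where "G \<xi> = p * \<bar>u \<xi>\<bar> powr (p - 1) * B \<xi> * ((W \<xi>)\<^sup>2 + 1) powr ((p - 1) / 2) * w \<xi> powr (1 - p)
      + (p - 1) * \<bar>u \<xi>\<bar> powr p * ((W \<xi>)\<^sup>2 + 1) powr (p / 2) * w \<xi> powr (- p)" for \<xi>
  have G_int: "integrable lborel G"
  proof (rule compact_support_integrable[OF compact_support_continuous[OF _ H K(1,2)] K(1)])
    show "continuous_on H G"
      unfolding G_def[abs_def] using p
      by (intro continuous_on_add continuous_on_mult continuous_on_const B_cont wp_cont Wp_cont up_cont)
        auto
  qed (auto simp: G_def K(3))
  have FG: "\<bar>F (\<epsilon> k) \<xi>\<bar> \<le> G \<xi>" for k \<xi>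
  proof -
    let ?E = "(W \<xi>)\<^sup>2 + \<epsilon> k"
    have E: "?E > 0" "?E \<le> (W \<xi>)\<^sup>2 + 1" using \<epsilon>[of k] by (auto intro: add_nonneg_pos)
    have "W \<xi> \<le> ?E powr (1 / 2)"
      using W[of \<xi>] \<epsilon>[of k] by (simp add: powr_half_sqrt real_le_rsqrt)
    then have "W \<xi> * ?E powr q \<le> ?E powr (1 / 2) * ?E powr q" by (rule mult_right_mono) simp
    also have "\<dots> = ?E powr ((p - 1) / 2)" by (simp add: powr_add[symmetric] q_def field_simps)
    also have "\<dots> \<le> ((W \<xi>)\<^sup>2 + 1) powr ((p - 1) / 2)" using E p by (intro powr_mono2) auto
    finally have 1: "W \<xi> * ?E powr q \<le> ((W \<xi>)\<^sup>2 + 1) powr ((p - 1) / 2)" .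
    have "(W \<xi>)\<^sup>2 * ?E powr q \<le> ?E powr 1 * ?E powr q"
      using \<epsilon>[of k] E by (intro mult_right_mono) auto
    also have "\<dots> = ?E powr (p / 2)" by (simp only: powr_add[symmetric]) (simp add: q_def field_simps)
    also have "\<dots> \<le> ((W \<xi>)\<^sup>2 + 1) powr (p / 2)" using E p by (intro powr_mono2) auto
    finally have 2: "(W \<xi>)\<^sup>2 * ?E powr q \<le> ((W \<xi>)\<^sup>2 + 1) powr (p / 2)" .
    have "\<bar>sgn (u \<xi>) * \<bar>u \<xi>\<bar> powr (p - 1)\<bar> = \<bar>u \<xi>\<bar> powr (p - 1)" by (simp add: abs_mult sgn_if)
    then have "\<bar>F (\<epsilon> k) \<xi>\<bar> \<le> p * \<bar>u \<xi>\<bar> powr (p - 1) * \<bar>Du \<xi> (V \<xi>)\<bar> * ?E powr q * w \<xi> powr (1 - p)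
      + (p - 1) * \<bar>u \<xi>\<bar> powr p * ?E powr q * (W \<xi>)\<^sup>2 * w \<xi> powr (- p)"
      unfolding F_def using p by (intro order_trans[OF abs_triangle_ineq4]) (simp add: abs_mult)
    also have "p * \<bar>u \<xi>\<bar> powr (p - 1) * \<bar>Du \<xi> (V \<xi>)\<bar> * ?E powr q * w \<xi> powr (1 - p)
      \<le> p * \<bar>u \<xi>\<bar> powr (p - 1) * (W \<xi> * B \<xi>) * ?E powr q * w \<xi> powr (1 - p)"
      using p DuV[of \<xi>] by (intro mult_right_mono mult_left_mono) auto
    also have "\<dots> = p * \<bar>u \<xi>\<bar> powr (p - 1) * B \<xi> * (W \<xi> * ?E powr q) * w \<xi> powr (1 - p)"
      by (simp only: mult_ac)
    also have "\<dots> \<le> p * \<bar>u \<xi>\<bar> powr (p - 1) * B \<xi> * ((W \<xi>)\<^sup>2 + 1) powr ((p - 1) / 2) * w \<xi> powr (1 - p)"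
      using p 1 by (intro mult_right_mono mult_left_mono) (auto simp: B_def)
    also have "(p - 1) * \<bar>u \<xi>\<bar> powr p * ?E powr q * (W \<xi>)\<^sup>2 * w \<xi> powr (- p)
       = (p - 1) * \<bar>u \<xi>\<bar> powr p * ((W \<xi>)\<^sup>2 * ?E powr q) * w \<xi> powr (- p)"
      by (simp only: mult_ac)
    also have "\<dots> \<le> (p - 1) * \<bar>u \<xi>\<bar> powr p * ((W \<xi>)\<^sup>2 + 1) powr (p / 2) * w \<xi> powr (- p)"
      using p 2 by (intro mult_right_mono mult_left_mono) auto
    finally show ?thesis unfolding G_def by simp
  qed
  have F_lim: "(\<lambda>k. F (\<epsilon> k) \<xi>) \<longlonglongrightarrow> F 0 \<xi>" for \<xi>
  proof (cases "W \<xi> = 0")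
    case True
    \<comment> \<open>At a zero of \<open>W\<close> both terms of \<open>F\<close> contain a
      vanishing factor, whatever \<open>\<epsilon>\<close> is, so the sequence is constantly
      0.\<close>
    then have "Du \<xi> (V \<xi>) = 0" using DuV[of \<xi>] by simp
    then show ?thesis using True by (simp add: F_def)
  next
    case False
    then have "(\<lambda>k. ((W \<xi>)\<^sup>2 + \<epsilon> k) powr q) \<longlonglongrightarrow> ((W \<xi>)\<^sup>2 + 0) powr q"
      by (intro tendsto_intros \<epsilon>_lim) auto
    then show ?thesis
    unfolding F_def by (intro tendsto_diff tendsto_mult tendsto_const)
  qed
  have F0_meas: "F 0 \<in> borel_measurable lborel"
    using F_meas[OF \<epsilon>(1)] by (intro borel_measurable_LIMSEQ_real[OF F_lim]) auto
  have "(\<lambda>k. integral\<^sup>L lborel (F (\<epsilon> k))) \<longlonglongrightarrow> integral\<^sup>L lborel (F 0)"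
    by (rule integral_dominated_convergence[OF F0_meas _ G_int])
      (use F_meas[OF \<epsilon>(1)] FG F_lim in auto)
  then have F0_int: "integral\<^sup>L lborel (F 0) = 0" using F_int[OF \<epsilon>(1)] by (simp add: LIMSEQ_const_iff)
  have F0_integrable: "integrable lborel (F 0)"
    by (rule integrable_dominated_convergence[where s = "\<lambda>k. F (\<epsilon> k)", OF F0_meas _ G_int])
      (use F_meas[OF \<epsilon>(1)] FG F_lim in auto)

  let ?I = "\<lambda>\<xi>. W \<xi> powr p / w \<xi> powr p * \<bar>u \<xi>\<bar> powr p"
  have pointwise: "c powr (p - 1) * F 0 \<xi> \<le> B \<xi> powr p - c powr p * ?I \<xi>" for \<xi>
  proof (cases "\<xi> \<in> H")
    case True
    \<comment> \<open>The \<open>p\<close>-th power of \<open>?A\<close> is the weighted integrand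
      \<open>?I\<close>; \<open>Young_hardy\<close> is applied with \<open>a = ?A\<close> and
      \<open>b = B \<xi>\<close>.\<close>
    let ?A = "W \<xi> * \<bar>u \<xi>\<bar> / w \<xi>"
    have wpos: "w \<xi> > 0" using w[OF True] .
    have A: "?A powr r = W \<xi> powr r * \<bar>u \<xi>\<bar> powr r * w \<xi> powr (- r)" for r
      using W[of \<xi>] wpos by (simp add: powr_mult powr_divide powr_minus field_simps)
    have "F 0 \<xi> \<le> p * ?A powr (p - 1) * B \<xi> - (p - 1) * ?A powr p"
    proof (cases "W \<xi> = 0")
      case True
      then have "Du \<xi> (V \<xi>) = 0" using DuV[of \<xi>] by simp
      then show ?thesis using True by (simp add: F_def)
    next
      case False
      then have Wp: "W \<xi> > 0" using W[of \<xi>] by simp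
      have Wq: "(W \<xi>)\<^sup>2 powr q = W \<xi> powr (p - 2)"
      proof -
        have "(W \<xi>)\<^sup>2 = W \<xi> powr 2" using Wp by simp
        moreover have "2 * q = p - 2" by (simp add: q_def)
        ultimately show ?thesis by (simp only: powr_powr)
      qed
      have "W \<xi> * W \<xi> powr (p - 2) = W \<xi> powr 1 * W \<xi> powr (p - 2)" using Wp by simp
      also have "\<dots> = W \<xi> powr (p - 1)" by (simp only: powr_add[symmetric]) simp
      finally have W1: "W \<xi> * W \<xi> powr (p - 2) = W \<xi> powr (p - 1)" .
      have "(W \<xi>)\<^sup>2 * W \<xi> powr (p - 2) = W \<xi> powr 2 * W \<xi> powr (p - 2)" using Wp by simp
      also have "\<dots> = W \<xi> powr p" by (simp only: powr_add[symmetric]) simp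
      finally have W2: "(W \<xi>)\<^sup>2 * W \<xi> powr (p - 2) = W \<xi> powr p" .
      have "sgn (u \<xi>) * Du \<xi> (V \<xi>) \<le> W \<xi> * B \<xi>"
        using DuV[of \<xi>] abs_ge_self[of "sgn (u \<xi>) * Du \<xi> (V \<xi>)"] W[of \<xi>]
        by (auto simp: sgn_if B_def split: if_splits)
      then have "(p * \<bar>u \<xi>\<bar> powr (p - 1) * W \<xi> powr (p - 2) * w \<xi> powr (1 - p)) * (sgn (u \<xi>) * Du \<xi> (V \<xi>))
        \<le> (p * \<bar>u \<xi>\<bar> powr (p - 1) * W \<xi> powr (p - 2) * w \<xi> powr (1 - p)) * (W \<xi> * B \<xi>)"
        using p by (intro mult_left_mono) auto
      also have "\<dots> = p * (\<bar>u \<xi>\<bar> powr (p - 1) * (W \<xi> * W \<xi> powr (p - 2)) * w \<xi> powr (1 - p)) * B \<xi>"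
        by (simp only: mult_ac)
      also have "\<dots> = p * ?A powr (p - 1) * B \<xi>" unfolding W1 A by (simp add: mult_ac)
      finally have "p * (sgn (u \<xi>) * \<bar>u \<xi>\<bar> powr (p - 1)) * Du \<xi> (V \<xi>) * W \<xi> powr (p - 2) * w \<xi> powr (1 - p)
        \<le> p * ?A powr (p - 1) * B \<xi>" by (simp only: mult_ac)
      moreover have "(p - 1) * \<bar>u \<xi>\<bar> powr p * W \<xi> powr (p - 2) * (W \<xi>)\<^sup>2 * w \<xi> powr (- p) = (p - 1) * ?A powr p"
        unfolding A W2[symmetric] by (simp only: mult_ac)
      ultimately show ?thesis unfolding F_def add_0_right Wq by linarith
    qed
    then have "c powr (p - 1) * F 0 \<xi> \<le> c powr (p - 1) * (p * ?A powr (p - 1) * B \<xi> - (p - 1) * ?A powr p)"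
      by (intro mult_left_mono) auto
    also have "\<dots> \<le> B \<xi> powr p - c powr p * ?A powr p"
      unfolding c_def using W[of \<xi>] wpos by (intro Young_hardy[OF p]) (auto simp: B_def)
    also have "?A powr p = ?I \<xi>" unfolding A by (simp add: powr_minus field_simps)
    finally show ?thesis .
  next
    case False
    then have "u \<xi> = 0" using K(2,3) by blast
    then show ?thesis by (simp add: F_def)
  qed
  have I_int: "integrable lborel ?I"
  proof (rule compact_support_integrable[OF compact_support_continuous[OF _ H K(1,2)] K(1)])
    show "continuous_on H ?I"
      using p w W
      by (intro continuous_on_mult continuous_on_divide wp_cont up_cont continuous_on_powr' W_cont
          continuous_on_const) (auto simp: less_imp_neq[symmetric])
  qed (auto simp: K(3))
  have B_int: "integrable lborel (\<lambda>\<xi>. B \<xi> powr p)"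
  proof (rule compact_support_integrable[OF _ K(1)])
    show "continuous_on UNIV (\<lambda>\<xi>. B \<xi> powr p)"
      using p by (intro continuous_on_powr' B_cont continuous_on_const) (auto simp: B_def)
  qed (simp add: B0)
  \<comment> \<open>The left side is 0, so the integrated pointwise bound is already the Hardy
    inequality over the whole space.\<close>
  have "c powr (p - 1) * integral\<^sup>L lborel (F 0) \<le> (\<integral>\<xi>. B \<xi> powr p - c powr p * ?I \<xi> \<partial>lborel)"
    unfolding integral_mult_right_zero[symmetric]
    by (intro integral_mono pointwise Bochner_Integration.integrable_diff integrable_mult_right
        F0_integrable I_int B_int)
  also have "\<dots> = (\<integral>\<xi>. B \<xi> powr p \<partial>lborel) - c powr p * integral\<^sup>L lborel ?I"
    by (subst Bochner_Integration.integral_diff[OF B_int integrable_mult_right[OF I_int]])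
      (simp only: integral_mult_right_zero)
  finally have "c powr p * integral\<^sup>L lborel ?I \<le> (\<integral>\<xi>. B \<xi> powr p \<partial>lborel)" using F0_int by simp
  moreover have "(LINT \<xi>:H|lborel. B \<xi> powr p) = (\<integral>\<xi>. B \<xi> powr p \<partial>lborel)"
    unfolding set_lebesgue_integral_def using K(2)
    by (intro Bochner_Integration.integral_cong refl) (auto simp: indicator_def intro!: B0)
  moreover have "(LINT \<xi>:H|lborel. ?I \<xi>) = integral\<^sup>L lborel ?I"
    unfolding set_lebesgue_integral_def using K(2)
    by (intro Bochner_Integration.integral_cong refl) (auto simp: indicator_def intro!: K(3))
  ultimately show ?thesis by (simp add: H_def B_def c_def W_def w_def)
qed

subsection \<open>Smooth functions\<close>

lemma C_k_continuous: "C_k k f \<Longrightarrow> continuous_on UNIV f"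
  by (cases k) (auto simp: continuous_at_imp_continuous_on differentiable_imp_continuous_within)

lemma C_k_Suc_imp: "C_k (Suc k) f \<Longrightarrow> C_k k f"
proof (induction k arbitrary: f)
  case 0
  then show ?case using C_k_continuous[of "Suc 0" f] by simp
next
  case (Suc k)
  have "C_k k (\<lambda>x. frechet_derivative f (at x) v)" for v
    using Suc.prems by (intro Suc.IH) (simp only: C_k.simps(2)[of "Suc k" f])
  then show ?case using Suc.prems by simp
qed

lemma C_k_SucI:
  assumes "\<And>x. (f has_derivative f' x) (at x)" "\<And>v. C_k k (\<lambda>x. f' x v)"
  shows "C_k (Suc k) f"
proof -
  have "frechet_derivative f (at x) = f' x" for x
    using frechet_derivative_at[OF assms(1)] by simp
  then show ?thesis using assms by (auto simp: differentiable_def)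
qed

lemma C_k_SucD:
  assumes "C_k (Suc k) f"
  shows "(f has_derivative frechet_derivative f (at x)) (at x)"
    and "C_k k (\<lambda>x. frechet_derivative f (at x) v)"
  using assms by (auto simp: frechet_derivative_works[symmetric])

lemma C_k_const: "C_k k (\<lambda>_. c)"
proof (induction k arbitrary: c)
  case (Suc k)
  show ?case by (rule C_k_SucI[OF has_derivative_const]) (rule Suc)
qed simp

lemma C_k_add: "C_k k f \<Longrightarrow> C_k k g \<Longrightarrow> C_k k (\<lambda>x. f x + g x)"
proof (induction k arbitrary: f g)
  case (Suc k)
  note f = C_k_SucD[OF Suc.prems(1)] and g = C_k_SucD[OF Suc.prems(2)]
  show ?case
    by (rule C_k_SucI[OF has_derivative_add[OF f(1) g(1)]]) (rule Suc.IH[OF f(2) g(2)])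
qed (auto intro: continuous_on_add)

lemma C_k_mult: "C_k k f \<Longrightarrow> C_k k g \<Longrightarrow> C_k k (\<lambda>x. f x * g x)"
proof (induction k arbitrary: f g)
  case (Suc k)
  note f = C_k_SucD[OF Suc.prems(1)] and g = C_k_SucD[OF Suc.prems(2)]
  show ?case
    by (rule C_k_SucI[OF has_derivative_mult[OF f(1) g(1)]])
      (intro C_k_add Suc.IH f(2) g(2) C_k_Suc_imp[OF Suc.prems(1)] C_k_Suc_imp[OF Suc.prems(2)])
qed (auto intro: continuous_on_mult)

text \<open>The derivative is constant in the base point. Proving the claim at \<open>Suc k\<close>
  and then lowering the order avoids an induction.\<close>

lemma C_k_bounded_linear: "bounded_linear f \<Longrightarrow> C_k k f"
  by (rule C_k_Suc_imp, rule C_k_SucI[OF bounded_linear_imp_has_derivative]) (auto intro: C_k_const)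

text \<open>The derivative of a quadratic form in a fixed direction is linear in the base point,
  which reduces the claim to \<open>C_k_bounded_linear\<close>. It serves the radial factor of the
  test functions.\<close>

lemma C_k_inner_self:
  assumes "bounded_linear L"
  shows "C_k k (\<lambda>x. L x \<bullet> L x)"
proof (rule C_k_Suc_imp, rule C_k_SucI)
  show "((\<lambda>x. L x \<bullet> L x) has_derivative (\<lambda>v. L x \<bullet> L v + L v \<bullet> L x)) (at x)" for x
    by (intro has_derivative_inner bounded_linear_imp_has_derivative assms)
  show "C_k k (\<lambda>x. L x \<bullet> L v + L v \<bullet> L x)" for v
    by (intro C_k_bounded_linear bounded_linear_add
        bounded_linear_compose[OF bounded_linear_inner_left assms]
        bounded_linear_compose[OF bounded_linear_inner_right assms])
qed

text \<open>By the chain rule the derivative is a product of the derivative of \<open>f\<close> with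
  \<open>h' (f x)\<close>. The latter is again a composition, of one order less, so the induction
  has to vary \<open>h\<close>.\<close>

lemma C_k_compose:
  fixes h :: "real \<Rightarrow> real"
  shows "C_k k h \<Longrightarrow> C_k k f \<Longrightarrow> C_k k (\<lambda>x. h (f x))"
proof (induction k arbitrary: f h)
  case 0
  then show ?case using continuous_on_compose2[of UNIV h UNIV f] by simp
next
  case (Suc k)
  note h = C_k_SucD[OF Suc.prems(1)] and f = C_k_SucD[OF Suc.prems(2)]
  have *: "frechet_derivative h (at y) v = v * frechet_derivative h (at y) 1" for y v
    using linear_scale[OF has_derivative_linear[OF h(1)], of y v 1] by simp
  have "((\<lambda>x. h (f x)) has_derivative
      (\<lambda>v. frechet_derivative f (at x) v * frechet_derivative h (at (f x)) 1)) (at x)" for x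
    by (rule has_derivative_eq_rhs[OF has_derivative_compose[OF f(1) h(1)]]) (rule ext, rule *)
  then show ?case
    by (rule C_k_SucI) (intro C_k_mult f(2) Suc.IH[OF h(2)] C_k_Suc_imp[OF Suc.prems(2)])
qed

lemma C_k_Suc_realI:
  fixes f :: "real \<Rightarrow> real"
  assumes "\<And>x. (f has_real_derivative f' x) (at x)" "C_k k f'"
  shows "C_k (Suc k) f"
  by (rule C_k_SucI[OF assms(1)[unfolded has_field_derivative_def]])
    (intro C_k_mult assms(2) C_k_const)

lemma C_k_Suc_realD:
  fixes f :: "real \<Rightarrow> real"
  assumes "C_k (Suc k) f"
  shows "(f has_real_derivative frechet_derivative f (at x) 1) (at x)"
    and "C_k k (\<lambda>x. frechet_derivative f (at x) 1)"
proof -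
  note f = C_k_SucD[OF assms]
  have "frechet_derivative f (at x) = (*) (frechet_derivative f (at x) 1)"
  proof
    show "frechet_derivative f (at x) v = frechet_derivative f (at x) 1 * v" for v
      using linear_scale[OF has_derivative_linear[OF f(1)], of x v 1] by simp
  qed
  then show "(f has_real_derivative frechet_derivative f (at x) 1) (at x)"
    using f(1)[of x] unfolding has_field_derivative_def by metis
  show "C_k k (\<lambda>x. frechet_derivative f (at x) 1)" by (rule f(2))
qed

lemma C_k_exp: "C_k k (\<lambda>s::real. exp (a * s))"
proof (induction k)
  case (Suc k)
  show ?case
    by (rule C_k_Suc_realI[where f' = "\<lambda>s. a * exp (a * s)"])
      (auto intro!: derivative_eq_intros C_k_mult C_k_const Suc)
qed (auto intro!: continuous_intros)

text \<open>For \<open>m = 0\<close> this is the standard smooth function that is flat at 0. The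
  powers of \<open>1 / x\<close> make the family closed, up to linear combinations, under
  differentiation.\<close>

definition flat_exp :: "nat \<Rightarrow> real \<Rightarrow> real" where
  "flat_exp m x = (if x > 0 then exp (- 1 / x) / x ^ m else 0)"

lemma flat_exp_has_derivative:
  "(flat_exp m has_real_derivative flat_exp (m + 2) x - m * flat_exp (m + 1) x) (at x)"
proof -
  consider "x > 0" | "x < 0" | "x = 0" by linarith
  then show ?thesis
  proof cases
    case 1
    have "((\<lambda>x. exp (- 1 / x) / x ^ m) has_real_derivative flat_exp (m + 2) x - m * flat_exp (m + 1) x) (at x)"
    proof (cases m)
      case 0
      then show ?thesis using 1
        by (auto intro!: derivative_eq_intros simp: flat_exp_def power2_eq_square)
    next
      case (Suc n)
      have "((\<lambda>x. exp (- 1 / x)) has_real_derivative exp (- 1 / x) / x\<^sup>2) (at x)"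
        using 1 by (auto intro!: derivative_eq_intros simp: power2_eq_square)
      from DERIV_divide[OF this DERIV_pow[of "Suc n"]] show ?thesis
        using 1 Suc by (auto simp: flat_exp_def field_simps power2_eq_square elim!: DERIV_cong)
    qed
    then show ?thesis
      by (rule has_field_derivative_transform_within_open[of _ _ _ "{0<..}"])
        (use 1 in \<open>auto simp: flat_exp_def\<close>)
  next
    case 2
    have "((\<lambda>_. 0) has_real_derivative flat_exp (m + 2) x - m * flat_exp (m + 1) x) (at x)"
      using 2 by (simp add: flat_exp_def)
    then show ?thesis
      by (rule has_field_derivative_transform_within_open[of _ _ _ "{..<0}"])
        (use 2 in \<open>auto simp: flat_exp_def\<close>)
  next
    case 3
    \<comment> \<open>With \<open>y = 1 / h\<close> the right difference quotient at 0 becomes a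
      power divided by an exponential.\<close>
    have "((\<lambda>y::real. y ^ (m + 1) / exp y) \<longlongrightarrow> 0) at_top"
      by (rule tendsto_power_div_exp_0)
    then have "((\<lambda>h::real. inverse h ^ (m + 1) / exp (inverse h)) \<longlongrightarrow> 0) (at_right 0)"
      by (rule filterlim_compose) (rule filterlim_inverse_at_top_right)
    then have "((\<lambda>h. flat_exp m h / h) \<longlongrightarrow> 0) (at_right 0)"
      by (rule Lim_transform_eventually)
        (auto simp: eventually_at_right_less flat_exp_def exp_minus field_simps
          intro!: eventually_mono[OF eventually_at_right_less])
    moreover have "((\<lambda>h. flat_exp m h / h) \<longlongrightarrow> 0) (at_left 0)"
      by (rule Lim_transform_eventually[OF tendsto_const])
        (auto simp: flat_exp_def eventually_at_filter)
    ultimately have "((\<lambda>h. flat_exp m h / h) \<longlongrightarrow> 0) (at 0)"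
      by (simp add: filterlim_split_at)
    then show ?thesis using 3 by (simp add: DERIV_def flat_exp_def)
  qed
qed

lemma C_k_flat_exp: "C_k k (flat_exp m)"
proof (induction k arbitrary: m)
  case 0
  show ?case
    using flat_exp_has_derivative by (auto intro!: DERIV_continuous_on)
next
  case (Suc k)
  have "flat_exp (m + 2) x - m * flat_exp (m + 1) x = flat_exp (m + 2) x + (- m) * flat_exp (m + 1) x"
    for x by simp
  then have "C_k k (\<lambda>x. flat_exp (m + 2) x - m * flat_exp (m + 1) x)"
    by (simp only:) (intro C_k_add C_k_mult C_k_const Suc)
  with flat_exp_has_derivative show ?case by (rule C_k_Suc_realI)
qed

text \<open>Since \<open>G\<close> vanishes below \<open>a\<close>, the composition vanishes for
  \<open>t < exp a\<close>, which removes the singularity of \<open>ln\<close> at 0. As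
  \<open>1 / t = exp (- ln t)\<close>, the derivative has the same shape with
  \<open>G' s * exp (- s)\<close> in place of \<open>G\<close>, so the induction closes.\<close>

lemma C_k_compose_ln:
  fixes G :: "real \<Rightarrow> real"
  shows "C_k k G \<Longrightarrow> (\<And>s. s < a \<Longrightarrow> G s = 0) \<Longrightarrow> C_k k (\<lambda>t. if t > 0 then G (ln t) else 0)"
proof (induction k arbitrary: G)
  case 0
  have z: "(if t > 0 then G (ln t) else 0) = 0" if "t < exp a" for t
    using that by (auto intro!: 0(2)) (metis exp_less_cancel_iff exp_ln)
  have "continuous_on ({0<..} \<union> {..<exp a}) (\<lambda>t. if t > 0 then G (ln t) else 0)"
  proof (rule continuous_on_open_Un)
    have "continuous_on {0<..} (\<lambda>t. G (ln t))"
      by (rule continuous_on_compose2[of UNIV G]) (use 0 in \<open>auto intro!: continuous_intros\<close>)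
    then show "continuous_on {0<..} (\<lambda>t. if t > 0 then G (ln t) else 0)"
      by (rule continuous_on_eq) auto
    show "continuous_on {..<exp a} (\<lambda>t. if t > 0 then G (ln t) else 0)"
      by (rule continuous_on_eq[OF continuous_on_const[of _ 0]]) (use z in auto)
  qed auto
  moreover have "{0<..} \<union> {..<exp a} = UNIV" using order.strict_trans1[OF _ exp_gt_zero[of a]] by (auto simp: not_less)
  ultimately show ?case by simp
next
  case (Suc k)
  note G = C_k_Suc_realD[OF Suc.prems(1)]
  let ?G' = "\<lambda>s. frechet_derivative G (at s) 1"
  let ?G1 = "\<lambda>s. ?G' s * exp (- 1 * s)"
  have G1: "?G1 s = 0" if "s < a" for s
  proof -
    have "((\<lambda>_. 0) has_real_derivative 0) (at s)" by simp
    then have "(G has_real_derivative 0) (at s)"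
      by (rule has_field_derivative_transform_within_open[of _ _ _ "{..<a}"])
        (use Suc.prems(2) that in auto)
    then show ?thesis using DERIV_unique[OF G(1)] by simp
  qed
  show ?case
  proof (rule C_k_Suc_realI)
    show "C_k k (\<lambda>t. if t > 0 then ?G1 (ln t) else 0)"
      by (rule Suc.IH[OF C_k_mult[OF G(2) C_k_exp] G1])
    fix t :: real
    show "((\<lambda>t. if t > 0 then G (ln t) else 0) has_real_derivative (if t > 0 then ?G1 (ln t) else 0)) (at t)"
    proof (cases "t > 0")
      case True
      then have "((\<lambda>t. G (ln t)) has_real_derivative ?G1 (ln t)) (at t)"
        using DERIV_chain2[OF G(1) DERIV_ln[OF True]] by (simp add: exp_minus)
      then have "((\<lambda>t. if t > 0 then G (ln t) else 0) has_real_derivative ?G1 (ln t)) (at t)"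
        by (rule has_field_derivative_transform_within_open[of _ _ _ "{0<..}"]) (use True in auto)
      then show ?thesis using True by simp
    next
      case False
      have "(if r > 0 then G (ln r) else 0) = 0" if "r < exp a" for r
        using that Suc.prems(2)[of "ln r"] by simp (metis exp_less_cancel_iff exp_ln)
      moreover have "t < exp a" using False exp_gt_zero[of a] by linarith
      ultimately have "((\<lambda>t. if t > 0 then G (ln t) else 0) has_real_derivative 0) (at t)"
        by (intro has_field_derivative_transform_within_open[OF DERIV_const[of 0], of "{..<exp a}"])
          simp_all
      then show ?thesis using False by simp
    qed
  qed
qed

subsection \<open>Sharpness of the constant\<close>

text \<open>The set where \<open>f\<close> is nonzero is both open and a null set, hence
  empty.\<close>

lemma continuous_integral_zero:
  fixes f :: "'a::euclidean_space \<Rightarrow> real"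
  assumes f: "continuous_on UNIV f" "\<And>x. f x \<ge> 0" "integrable lborel f" "integral\<^sup>L lborel f = 0"
  shows "f x = 0"
proof (rule ccontr)
  assume "f x \<noteq> 0"
  let ?S = "{x. f x \<noteq> 0}"
  have "AE x in lborel. f x = 0"
    using f integral_nonneg_eq_0_iff_AE[OF f(3)] by auto
  then have "?S \<in> null_sets lborel"
    using borel_measurable_continuous_onI[OF f(1)] by (subst AE_iff_null_sets) auto
  then have "negligible ?S"
    by (simp add: negligible_iff_null_sets null_sets_completionI)
  moreover have "open ?S"
    using open_Collect_neq[OF f(1) continuous_on_const[of UNIV 0]] by simp
  ultimately show False using open_not_negligible \<open>f x \<noteq> 0\<close> by blast
qed

section \<open>Cylinders and the logarithmic change of the vertical variable\<close>

definition cylinder :: "real set \<Rightarrow> 'n::finite heisenberg set" where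
  "cylinder I = {\<xi>. norm (fst \<xi>, fst (snd \<xi>)) \<le> 1 \<and> snd (snd \<xi>) \<in> I}"

lemma mem_cylinder: "(x, y, t) \<in> cylinder I \<longleftrightarrow> norm (x, y) \<le> 1 \<and> t \<in> I"
  by (simp add: cylinder_def)

lemma compact_cylinder:
  assumes "compact I"
  shows "compact (cylinder I)"
proof -
  have eq: "cylinder I = (\<lambda>(z, t). (fst z, snd z, t)) ` (cball 0 1 \<times> I)"
    by (force simp: cylinder_def image_iff)
  then show ?thesis
    using assms unfolding eq case_prod_beta
    by (intro compact_continuous_image continuous_intros compact_Times) auto
qed

text \<open>Substitute \<open>t = exp (N * s)\<close>: the measure \<open>dt / t\<close> becomes
  \<open>N ds\<close>.\<close>

lemma nn_integral_log_substitution: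
  fixes h :: "real \<Rightarrow> ennreal"
  assumes [measurable]: "h \<in> borel_measurable borel" and N: "N > 0"
  shows "(\<integral>\<^sup>+t. h (ln t / N) * ennreal (1 / t) * indicator {exp (- 2 * N)..exp (- N)} t \<partial>lborel)
    = (\<integral>\<^sup>+s. ennreal N * (h s * indicator {- 2.. - 1} s) \<partial>lborel)"
proof -
  \<comment> \<open>The endpoints are written as values of \<open>exp (N * s)\<close> at
    \<open>s = - 2\<close> and \<open>s = - 1\<close> to fit the substitution rule.\<close>
  have "(\<integral>\<^sup>+t. h (ln t / N) * ennreal (1 / t) * indicator {exp (N * - 2)..exp (N * - 1)} t \<partial>lborel)
     = (\<integral>\<^sup>+s. h (ln (exp (N * s)) / N) * ennreal (1 / exp (N * s)) * ennreal (N * exp (N * s))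
          * indicator {- 2.. - 1} s \<partial>lborel)"
    by (rule nn_integral_substitution_aux)
      (use N in \<open>auto intro!: derivative_eq_intros continuous_intros\<close>)
  also have "\<dots> = (\<integral>\<^sup>+s. ennreal N * (h s * indicator {- 2.. - 1} s) \<partial>lborel)"
  proof (rule nn_integral_cong)
    fix s
    have "ennreal (1 / exp (N * s)) * ennreal (N * exp (N * s)) = ennreal N"
      using N by (subst ennreal_mult[symmetric]) auto
    then show "h (ln (exp (N * s)) / N) * ennreal (1 / exp (N * s)) * ennreal (N * exp (N * s))
          * indicator {- 2.. - 1} s = ennreal N * (h s * indicator {- 2.. - 1} s)"
      using N by (simp add: mult.assoc) (simp add: mult_ac)
  qed
  finally show ?thesis by (simp add: mult.commute)
qed

lemma nn_integral_triple:
  fixes f :: "'a::euclidean_space \<times> 'b::euclidean_space \<times> 'c::euclidean_space \<Rightarrow> ennreal"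
  assumes f: "f \<in> borel_measurable borel"
  shows "integral\<^sup>N lborel f = (\<integral>\<^sup>+x. \<integral>\<^sup>+y. \<integral>\<^sup>+t. f (x, y, t) \<partial>lborel \<partial>lborel \<partial>lborel)"
proof -
  have f1: "f \<in> borel_measurable (lborel \<Otimes>\<^sub>M lborel)" using f by (simp add: lborel_prod)
  have f2: "(\<lambda>z. f (x, z)) \<in> borel_measurable (lborel \<Otimes>\<^sub>M lborel)" for x
    unfolding lborel_prod using f by measurable
  have "integral\<^sup>N lborel f = (\<integral>\<^sup>+x. \<integral>\<^sup>+z. f (x, z) \<partial>lborel \<partial>lborel)"
    using lborel.nn_integral_fst[OF f1] by (simp add: lborel_prod)
  also have "\<dots> = (\<integral>\<^sup>+x. \<integral>\<^sup>+y. \<integral>\<^sup>+t. f (x, y, t) \<partial>lborel \<partial>lborel \<partial>lborel)"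
    using lborel.nn_integral_fst[OF f2] by (simp add: lborel_prod)
  finally show ?thesis .
qed

text \<open>Tonelli isolates the vertical integral, where the logarithmic substitution applies, and
  then reassembles the triple integral. Nonnegativity allows working in \<open>ennreal\<close> and
  returning to the Bochner integral at the end.\<close>

lemma integral_log_cylinder:
  fixes g :: "'n::finite heisenberg \<Rightarrow> real"
  assumes g: "continuous_on UNIV g" "\<And>\<xi>. g \<xi> \<ge> 0" and N: "N > 0"
  defines "G \<equiv> \<lambda>(x, y, t). indicator (cylinder {exp (- 2 * N)..exp (- N)}) (x, y, t) * (g (x, y, ln t / N) / t)"
  shows "integrable lborel G"
    and "integral\<^sup>L lborel G = N * (\<integral>\<xi>. indicator (cylinder {- 2.. - 1}) \<xi> * g \<xi> \<partial>lborel)"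
proof -
  let ?I = "{exp (- 2 * N)..exp (- N)}" and ?J = "{- 2.. - 1 :: real}"
  have G_alt: "G = (\<lambda>\<xi>. indicator (cylinder ?I) \<xi> *\<^sub>R (g (fst \<xi>, fst (snd \<xi>), ln (snd (snd \<xi>)) / N) / snd (snd \<xi>)))"
    by (auto simp: G_def fun_eq_iff)
  have pos: "snd (snd \<xi>) > 0" if "\<xi> \<in> cylinder ?I" for \<xi> :: "'n heisenberg"
    using that less_le_trans[OF exp_gt_zero] by (auto simp: cylinder_def)
  have "continuous_on (cylinder ?I) (\<lambda>\<xi>. g (fst \<xi>, fst (snd \<xi>), ln (snd (snd \<xi>)) / N) / snd (snd \<xi>))"
    by (intro continuous_intros continuous_on_compose2[OF g(1)])
      (use N in \<open>auto simp: mem_cylinder\<close>)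
  then show int: "integrable lborel G"
    unfolding G_alt by (intro borel_integrable_compact compact_cylinder) auto
  have g_meas [measurable]: "g \<in> borel_measurable borel" using borel_measurable_continuous_onI[OF g(1)] .
  define B where "B = {\<xi> :: 'n heisenberg. norm (fst \<xi>, fst (snd \<xi>)) \<le> 1}"
  have [measurable]: "B \<in> sets borel"
    unfolding B_def by (intro borel_closed closed_Collect_le continuous_intros)
  \<comment> \<open>Only the condition on \<open>(x, y)\<close> is absorbed into \<open>h\<close>;
    the condition on \<open>t\<close> stays a separate indicator, which the substitution
    transforms.\<close>
  define h where "h \<xi> = ennreal (g \<xi>) * indicator B \<xi>" for \<xi>
  have h_meas: "h \<in> borel_measurable borel" unfolding h_def[abs_def] by measurable
  have h_meas': "(\<lambda>t. h (x, y, t)) \<in> borel_measurable borel" for x y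
    using h_meas by measurable
  have J: "(\<lambda>\<xi>. h \<xi> * indicator ?J (snd (snd \<xi>))) \<in> borel_measurable borel"
  proof -
    have [measurable]: "(\<lambda>\<xi>::'n heisenberg. snd (snd \<xi>)) \<in> borel_measurable borel"
      by (intro borel_measurable_continuous_onI continuous_intros)
    show ?thesis using h_meas by measurable
  qed
  have "(\<integral>\<^sup>+\<xi>. ennreal (G \<xi>) \<partial>lborel) = (\<integral>\<^sup>+x. \<integral>\<^sup>+y. \<integral>\<^sup>+t. ennreal (G (x, y, t)) \<partial>lborel \<partial>lborel \<partial>lborel)"
    using int by (intro nn_integral_triple) auto
  also have "\<dots> = (\<integral>\<^sup>+x. \<integral>\<^sup>+y. \<integral>\<^sup>+t. h (x, y, ln t / N) * ennreal (1 / t) * indicator ?I t \<partial>lborel \<partial>lborel \<partial>lborel)"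
  proof (intro nn_integral_cong)
    fix x y :: "real ^ 'n" and t
    have "t > 0" if "t \<in> ?I" using that less_le_trans[OF exp_gt_zero] by auto
    then show "ennreal (G (x, y, t)) = h (x, y, ln t / N) * ennreal (1 / t) * indicator ?I t"
      using g(2)[of "(x, y, ln t / N)"]
      by (auto simp: G_def h_def B_def mem_cylinder indicator_def ennreal_mult[symmetric])
  qed
  also have "\<dots> = (\<integral>\<^sup>+x. \<integral>\<^sup>+y. \<integral>\<^sup>+s. ennreal N * (h (x, y, s) * indicator ?J s) \<partial>lborel \<partial>lborel \<partial>lborel)"
    by (simp only: nn_integral_log_substitution[OF h_meas' N])
  also have "\<dots> = (\<integral>\<^sup>+\<xi>. ennreal N * (h \<xi> * indicator ?J (snd (snd \<xi>))) \<partial>lborel)"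
    using J by (subst nn_integral_triple) auto
  also have "\<dots> = ennreal N * (\<integral>\<^sup>+\<xi>. h \<xi> * indicator ?J (snd (snd \<xi>)) \<partial>lborel)"
    using J by (intro nn_integral_cmult) auto
  also have "(\<integral>\<^sup>+\<xi>. h \<xi> * indicator ?J (snd (snd \<xi>)) \<partial>lborel)
      = (\<integral>\<^sup>+\<xi>. ennreal (indicator (cylinder ?J) \<xi> * g \<xi>) \<partial>lborel)"
    by (intro nn_integral_cong) (auto simp: h_def B_def cylinder_def indicator_def)
  finally have eq: "(\<integral>\<^sup>+\<xi>. ennreal (G \<xi>) \<partial>lborel)
      = ennreal N * (\<integral>\<^sup>+\<xi>. ennreal (indicator (cylinder ?J) \<xi> * g \<xi>) \<partial>lborel)" .
  have G_nonneg: "G \<xi> \<ge> 0" for \<xi>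
    using g(2) pos[of \<xi>] by (cases "\<xi> \<in> cylinder ?I") (auto simp: G_alt)
  have [measurable]: "cylinder ?J \<in> sets (borel :: 'n heisenberg measure)"
    by (intro borel_closed compact_imp_closed compact_cylinder) simp
  show "integral\<^sup>L lborel G = N * (\<integral>\<xi>. indicator (cylinder ?J) \<xi> * g \<xi> \<partial>lborel)"
    using int G_nonneg g(2) N
    by (subst (1 2) integral_eq_nn_integral) (auto simp: eq enn2real_mult)
qed

section \<open>Construction of the asymptotically extremal test functions\<close>

definition cutoff :: "real \<Rightarrow> real" where
  "cutoff s = flat_exp 0 (s + 2) * flat_exp 0 (- s - 1)"

text \<open>The power \<open>t powr c\<close> is written through \<open>ln t\<close> so that
  \<open>C_k_compose_ln\<close> applies. Its derivative is \<open>c * t powr c / t\<close>, which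
  matches the equality case of \<open>Young_hardy\<close>.\<close>

definition profile :: "real \<Rightarrow> real \<Rightarrow> real \<Rightarrow> real" where
  "profile c N t = (if t > 0 then exp (c * ln t) * cutoff (ln t / N) else 0)"

definition radial :: "'a::real_inner \<Rightarrow> real" where
  "radial z = flat_exp 0 (1 - z \<bullet> z)"

text \<open>Minimizing is meant asymptotically: for \<open>c = (p - 1) / p\<close> the quotient of
  the two integrals approaches the Hardy constant as \<open>N\<close> tends to infinity.\<close>

definition hardy_minimizer :: "real \<Rightarrow> real \<Rightarrow> 'n::finite heisenberg \<Rightarrow> real" where
  "hardy_minimizer c N = (\<lambda>(x, y, t). profile c N t * radial (x, y))"

lemma flat_exp_bounds: "0 \<le> flat_exp 0 s" "flat_exp 0 s \<le> 1"
  by (auto simp: flat_exp_def)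

lemma continuous_on_flat_exp [continuous_intros]:
  "continuous_on S f \<Longrightarrow> continuous_on S (\<lambda>x. flat_exp m (f x))"
  using continuous_on_compose2[OF C_k_continuous[OF C_k_flat_exp[of 0 m]]] by auto

lemma cutoff_bounds: "0 \<le> cutoff s" "cutoff s \<le> 1"
  unfolding cutoff_def by (intro mult_nonneg_nonneg mult_le_one flat_exp_bounds)+

lemma cutoff_eq_0: "s \<notin> {- 2.. - 1} \<Longrightarrow> cutoff s = 0"
  by (auto simp: cutoff_def flat_exp_def)

lemma C_k_affine: "C_k k (\<lambda>s::real. a * s + b)"
  by (intro C_k_add C_k_const C_k_bounded_linear bounded_linear_mult_right)

lemma C_k_cutoff: "C_k k cutoff"
proof -
  have "C_k k (\<lambda>s. flat_exp 0 (1 * s + 2) * flat_exp 0 ((- 1) * s + (- 1)))"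
    by (intro C_k_mult C_k_compose[OF C_k_flat_exp] C_k_affine)
  then show ?thesis by (simp add: cutoff_def[abs_def])
qed

lemma cutoff_has_derivative:
  obtains cutoff' M where "\<And>s. (cutoff has_real_derivative cutoff' s) (at s)"
    "\<And>s. \<bar>cutoff' s\<bar> \<le> M" "\<And>s. s \<notin> {- 2.. - 1} \<Longrightarrow> cutoff' s = 0"
proof -
  note D = C_k_Suc_realD[OF C_k_cutoff[of "Suc 0"]]
  let ?D = "\<lambda>s. frechet_derivative cutoff (at s) 1"
  have D0: "?D s = 0" if "s \<notin> {- 2.. - 1}" for s
  proof -
    have "(cutoff has_real_derivative 0) (at s)"
      by (rule has_field_derivative_transform_within_open[OF DERIV_const[of 0], of "- {- 2.. - 1}"])
        (use that in \<open>simp_all add: cutoff_eq_0 open_Compl\<close>)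
    then show ?thesis using D(1) DERIV_unique by blast
  qed
  from compact_support_bounded[OF C_k_continuous[OF D(2)] compact_Icc D0]
  obtain M where "\<And>s. \<bar>?D s\<bar> \<le> M" by blast
  with D(1) D0 show thesis by (intro that)
qed

lemma C_k_profile:
  assumes "N > 0"
  shows "C_k k (profile c N)"
proof -
  have "C_k k (\<lambda>s. exp (c * s) * cutoff (1 / N * s + 0))"
    by (intro C_k_mult C_k_exp C_k_compose[OF C_k_cutoff] C_k_affine)
  then have "C_k k (\<lambda>s. exp (c * s) * cutoff (s / N))" by simp
  moreover have "exp (c * s) * cutoff (s / N) = 0" if "s < - 2 * N" for s
    using that assms by (simp add: cutoff_eq_0 field_simps)
  ultimately show ?thesis
    unfolding profile_def[abs_def] by (rule C_k_compose_ln)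
qed

lemma log_mem_iff:
  fixes N t :: real
  assumes "N > 0" "t > 0"
  shows "ln t / N \<in> {- 2.. - 1} \<longleftrightarrow> t \<in> {exp (- 2 * N)..exp (- N)}"
proof -
  have "ln t / N \<in> {- 2.. - 1} \<longleftrightarrow> - 2 * N \<le> ln t \<and> ln t \<le> - N"
    using assms(1) by (auto simp: field_simps)
  moreover have "ln t \<le> - N \<longleftrightarrow> t \<le> exp (- N)"
    using assms(2) by (metis exp_le_cancel_iff exp_ln)
  ultimately show ?thesis using assms(2) by (simp add: ln_ge_iff)
qed

lemma profile_eq_0:
  assumes "N > 0" "t \<notin> {exp (- 2 * N)..exp (- N)}"
  shows "profile c N t = 0"
  using assms log_mem_iff[of N t] by (auto simp: profile_def cutoff_eq_0 simp del: atLeastAtMost_iff)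

lemma C_k_hardy_minimizer:
  assumes "N > 0"
  shows "C_k k (hardy_minimizer c N :: 'n::finite heisenberg \<Rightarrow> real)"
proof -
  have L: "bounded_linear (\<lambda>\<xi>::'n heisenberg. (fst \<xi>, fst (snd \<xi>)))" "bounded_linear (\<lambda>\<xi>::'n heisenberg. snd (snd \<xi>))"
    by (intro bounded_linear_Pair bounded_linear_fst bounded_linear_snd
        bounded_linear_fst_comp bounded_linear_snd_comp)+
  have eq: "hardy_minimizer c N = (\<lambda>\<xi>::'n heisenberg. profile c N (snd (snd \<xi>)) *
    flat_exp 0 (1 + (- 1) * ((fst \<xi>, fst (snd \<xi>)) \<bullet> (fst \<xi>, fst (snd \<xi>)))))"
    by (simp add: fun_eq_iff hardy_minimizer_def radial_def algebra_simps)
  show ?thesis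
    unfolding eq
    by (intro C_k_mult C_k_compose[OF C_k_profile[OF assms]] C_k_compose[OF C_k_flat_exp] C_k_add
        C_k_const C_k_bounded_linear[OF L(2)] C_k_inner_self[OF L(1)])
qed

lemma norm_gt_1_imp: "norm z > 1 \<Longrightarrow> 1 - z \<bullet> z < 0"
  by (simp add: norm_eq_sqrt_inner)

lemma hardy_minimizer_eq_0:
  assumes "N > 0" "\<xi> \<notin> cylinder {exp (- 2 * N)..exp (- N)}"
  shows "hardy_minimizer c N \<xi> = 0"
proof (cases \<xi>)
  case (fields x y t)
  then show ?thesis
    using assms profile_eq_0[OF assms(1), of t c] norm_gt_1_imp[of "(x, y)"]
    by (auto simp: mem_cylinder hardy_minimizer_def radial_def flat_exp_def not_le
        simp del: inner_Pair atLeastAtMost_iff)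
qed

lemma hardy_minimizer_test_function:
  assumes "N > 0"
  shows "hardy_minimizer c N \<in> test_functions (half_space (0, 0, 1) 0)"
proof -
  let ?Q = "cylinder {exp (- 2 * N)..exp (- N)}"
  have Q: "compact ?Q" by (rule compact_cylinder) simp
  have "{\<xi>. hardy_minimizer c N \<xi> \<noteq> 0} \<subseteq> ?Q" using hardy_minimizer_eq_0[OF assms] by blast
  then have sub: "closure {\<xi>. hardy_minimizer c N \<xi> \<noteq> 0} \<subseteq> ?Q"
    using Q by (intro closure_minimal compact_imp_closed)
  moreover have "?Q \<subseteq> half_space (0, 0, 1) 0"
    using less_le_trans[OF exp_gt_zero] by (auto simp: cylinder_def half_space_def inner_prod_def)
  moreover have "compact (closure {\<xi>. hardy_minimizer c N \<xi> \<noteq> 0})"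
    using sub Q by (metis closed_closure compact_Int_closed inf.absorb_iff2 inf_commute)
  ultimately show ?thesis
    using C_k_hardy_minimizer[OF assms] unfolding test_functions_def by blast
qed

text \<open>The first summand differentiates the profile, the horizontal gradient of
  \<open>t\<close> being \<open>2 (y, - x)\<close>. The second differentiates the radial factor,
  with \<open>flat_exp 2\<close> the derivative of \<open>flat_exp 0\<close>.\<close>

lemma horizontal_gradient_hardy_minimizer:
  assumes "t > 0" "(cutoff has_real_derivative \<kappa>) (at (ln t / N))" "N > 0"
  shows "horizontal_gradient (hardy_minimizer c N) (x, y, t) =
    (2 * t powr (c - 1) * (c * cutoff (ln t / N) + \<kappa> / N) * radial (x, y)) *\<^sub>R (y, - x)
    - (2 * t powr c * cutoff (ln t / N) * flat_exp 2 (1 - (x, y) \<bullet> (x, y))) *\<^sub>R (x, y)"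
proof -
  let ?f' = "t powr (c - 1) * (c * cutoff (ln t / N) + \<kappa> / N)"
  let ?f = "t powr c * cutoff (ln t / N)"
  have k: "((\<lambda>t. cutoff (ln t / N)) has_real_derivative \<kappa> * (1 / t / N)) (at t)"
    by (rule DERIV_chain2[where g = "\<lambda>t. ln t / N", OF assms(2)])
      (use assms in \<open>auto intro!: derivative_eq_intros\<close>)
  have e: "((\<lambda>t. exp (c * ln t)) has_real_derivative exp (c * ln t) * (c / t)) (at t)"
    using assms(1) by (auto intro!: derivative_eq_intros)
  note DERIV_mult[OF e k]
  moreover have "exp (c * ln t) * (c / t) * cutoff (ln t / N) + \<kappa> * (1 / t / N) * exp (c * ln t) = ?f'"
  proof -
    have "t powr (c - 1) = exp (c * ln t) / t"
      using assms(1) by (simp add: powr_diff) (simp add: powr_def)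
    then show ?thesis by (simp add: algebra_simps add_divide_distrib)
  qed
  ultimately have "((\<lambda>t. exp (c * ln t) * cutoff (ln t / N)) has_real_derivative ?f') (at t)" by simp
  then have f': "(profile c N has_real_derivative ?f') (at t)"
    by (rule has_field_derivative_transform_within_open[of _ _ _ "{0<..}"])
      (use assms(1) in \<open>auto simp: profile_def\<close>)
  have f: "profile c N t = ?f" using assms(1) by (simp add: profile_def powr_def)
  let ?\<rho> = "flat_exp 2 (1 - (x, y) \<bullet> (x, y))"
  have \<rho>: "(flat_exp 0 has_real_derivative ?\<rho>) (at (1 - (x, y) \<bullet> (x, y)))"
    using flat_exp_has_derivative[of 0] by (simp add: numeral_2_eq_2)
  have t: "((\<lambda>\<xi>. profile c N (snd (snd \<xi>))) has_derivative (\<lambda>h. ?f' * snd (snd h))) (at (x, y, t))"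
    by (rule has_derivative_compose[of "\<lambda>\<xi>. snd (snd \<xi>)" "\<lambda>h. snd (snd h)" "(x, y, t)" UNIV
          "profile c N" "(*) ?f'"])
      (use f' in \<open>auto intro!: derivative_intros simp: has_field_derivative_def\<close>)
  have "((\<lambda>\<xi>. 1 - (fst \<xi>, fst (snd \<xi>)) \<bullet> (fst \<xi>, fst (snd \<xi>))) has_derivative
      (\<lambda>h. - 2 * ((x, y) \<bullet> (fst h, fst (snd h))))) (at (x, y, t))"
    by (auto intro!: derivative_eq_intros simp: inner_commute algebra_simps)
  from has_derivative_compose[OF this, of "flat_exp 0" "(*) ?\<rho>"] \<rho>
  have z: "((\<lambda>\<xi>. radial (fst \<xi>, fst (snd \<xi>))) has_derivative
      (\<lambda>h. ?\<rho> * (- 2 * ((x, y) \<bullet> (fst h, fst (snd h)))))) (at (x, y, t))"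
    by (simp add: has_field_derivative_def radial_def)
  have "(hardy_minimizer c N has_derivative (\<lambda>h. ?f * (?\<rho> * (- 2 * ((x, y) \<bullet> (fst h, fst (snd h)))))
      + ?f' * snd (snd h) * radial (x, y))) (at (x, y, t))"
    using has_derivative_mult[OF t z] by (simp add: hardy_minimizer_def case_prod_unfold f)
  from frechet_derivative_at[OF this]
  have D: "frechet_derivative (hardy_minimizer c N) (at (x, y, t)) =
     (\<lambda>h. ?f * (?\<rho> * (- 2 * ((x, y) \<bullet> (fst h, fst (snd h))))) + ?f' * snd (snd h) * radial (x, y))"
    by simp
  show ?thesis
    unfolding horizontal_gradient_def D
    by (simp add: X_field_def Y_field_def vec_eq_iff inner_axis algebra_simps)
qed

lemma angle_function_vertical: "angle_function (0, 0, 1) (x, y, t) = 2 * norm (x, y)"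
proof -
  have "horizontal_normal (0, 0, 1) (x, y, t) = 2 *\<^sub>R (y, - x)"
    by (simp add: horizontal_normal_def)
  then show ?thesis
    by (simp only: angle_function_eq_norm norm_scaleR) (simp add: norm_prod_def add.commute)
qed

text \<open>Testing with \<open>hardy_minimizer\<close> and cancelling the common factor
  \<open>N\<close> gives \<open>C * J \<le> I n\<close>. Here \<open>I n\<close> tends to
  \<open>c powr p * J\<close>, and \<open>J > 0\<close> can be cancelled.\<close>

lemma hardy_half_space_sharp:
  fixes p C :: real
  assumes p: "p > 1"
    and hardy: "\<And>u :: 'n::finite heisenberg \<Rightarrow> real. u \<in> test_functions (half_space (0, 0, 1) 0) \<Longrightarrow>
      C * (LINT \<xi>:half_space (0, 0, 1) 0|lborel.
        angle_function (0, 0, 1) \<xi> powr p / boundary_dist (0, 0, 1) 0 \<xi> powr p * \<bar>u \<xi>\<bar> powr p)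
      \<le> (LINT \<xi>:half_space (0, 0, 1) 0|lborel. norm (horizontal_gradient u \<xi>) powr p)"
  shows "C \<le> ((p - 1) / p) powr p"
proof -
  define c where "c = (p - 1) / p"
  \<comment> \<open>The second identity turns the powers of \<open>t\<close> in both integrands into
    exactly \<open>1 / t\<close>, the weight of the logarithmic substitution.\<close>
  have c: "c > 0" "(c - 1) * p = - 1" using p by (auto simp: c_def field_simps)
  obtain cutoff' M1 where cutoff': "\<And>s. (cutoff has_real_derivative cutoff' s) (at s)"
    "\<And>s. \<bar>cutoff' s\<bar> \<le> M1" "\<And>s. s \<notin> {- 2.. - 1} \<Longrightarrow> cutoff' s = 0"
    using cutoff_has_derivative by blast
  have "compact (flat_exp 2 ` {0..1})"
    by (intro compact_continuous_image continuous_intros) auto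
  then have "\<exists>M. \<forall>s\<in>{0..1}. \<bar>flat_exp 2 s\<bar> \<le> M"
    by (auto dest!: compact_imp_bounded simp: bounded_iff)
  then obtain M2 where M2: "\<bar>flat_exp 2 s\<bar> \<le> M2" if "s \<in> {0..1}" for s by blast
  \<comment> \<open>The error constant: \<open>M1\<close> bounds the derivative of the cutoff,
    \<open>M2\<close> that of the radial factor, and the 2s come from the horizontal gradient
    formula.\<close>
  define k where "k = 2 * M1 + 2 * M2"
  have "M1 \<ge> 0" "M2 \<ge> 0" using cutoff'(2)[of 0] M2[of 0] by auto
  then have k: "k \<ge> 0" by (simp add: k_def)
  \<comment> \<open>In the variable \<open>s = ln t / N\<close>, the angle function times
    \<open>u\<close> over the distance is \<open>t powr (c - 1) * m\<close>; the gradient norm is at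
    most \<open>t powr (c - 1) * (c * m + k / N)\<close>.\<close>
  define m where "m \<xi> = cutoff (snd (snd \<xi>)) * (2 * norm (fst \<xi>, fst (snd \<xi>)) * radial (fst \<xi>, fst (snd \<xi>)))"
    for \<xi> :: "'n heisenberg"
  have m_nonneg: "m \<xi> \<ge> 0" for \<xi>
    unfolding m_def radial_def by (intro mult_nonneg_nonneg cutoff_bounds flat_exp_bounds) auto
  have m_cont: "continuous_on S m" for S
    unfolding m_def radial_def
    by (intro continuous_intros continuous_on_compose2[OF C_k_continuous[OF C_k_cutoff[of 0]]]) auto
  define Q where "Q = (cylinder {- 2.. - 1} :: 'n heisenberg set)"
  have Q: "compact Q" unfolding Q_def by (rule compact_cylinder) simp
  have m_eq_0: "m \<xi> = 0" if "\<xi> \<notin> Q" for \<xi>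
    using that norm_gt_1_imp[of "(fst \<xi>, fst (snd \<xi>))"] cutoff_eq_0[of "snd (snd \<xi>)"]
    by (auto simp: m_def Q_def cylinder_def radial_def flat_exp_def not_le
        simp del: inner_Pair atLeastAtMost_iff)
  define N where "N n = real (Suc n)" for n
  have N: "N n > 0" "N n \<ge> 1" for n by (auto simp: N_def)
  define J where "J = (\<integral>\<xi>. indicator Q \<xi> * m \<xi> powr p \<partial>lborel)"
  define I where "I n = (\<integral>\<xi>. indicator Q \<xi> * (c * m \<xi> + k / N n) powr p \<partial>lborel)" for n
  have mp_cont: "continuous_on S (\<lambda>\<xi>. m \<xi> powr p)" for S
    using p m_nonneg by (intro continuous_on_powr' m_cont continuous_on_const) auto
  have mk_cont: "continuous_on S (\<lambda>\<xi>. (c * m \<xi> + k / N n) powr p)" for S n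
    using p m_nonneg c k N[of n]
    by (intro continuous_on_powr' continuous_on_add continuous_on_mult m_cont continuous_on_const) auto

  have upper: "C * J \<le> I n" for n
  proof -
    define u where "u = (hardy_minimizer c (N n) :: 'n heisenberg \<Rightarrow> real)"
    let ?H = "half_space (0, 0, 1) 0 :: 'n heisenberg set"
    let ?QN = "cylinder {exp (- 2 * N n)..exp (- N n)} :: 'n heisenberg set"
    have H: "(x, y, t) \<in> ?H \<longleftrightarrow> t > 0" for x y t by (simp add: half_space_def)
    have cyl: "(x, y, t) \<in> ?QN \<longleftrightarrow> (x, y, ln t / N n) \<in> Q" if "t > 0" for x y t
      using log_mem_iff[OF N(1)[of n] that] by (simp add: mem_cylinder Q_def)
    have QN_pos: "t > 0" if "(x, y, t) \<in> ?QN" for x y t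
      using that less_le_trans[OF exp_gt_zero] by (auto simp: mem_cylinder)
    have "angle_function (0, 0, 1) \<xi> powr p / boundary_dist (0, 0, 1) 0 \<xi> powr p * \<bar>u \<xi>\<bar> powr p * indicator ?H \<xi>
      = (case \<xi> of (x, y, t) \<Rightarrow> indicator ?QN (x, y, t) * (m (x, y, ln t / N n) powr p / t))" for \<xi>
    proof (cases \<xi>)
      case (fields x y t)
      show ?thesis
      proof (cases "t > 0")
        case True
        let ?r = "norm (x, y)" and ?\<rho> = "radial (x, y)" and ?b = "cutoff (ln t / N n)"
        have nonneg: "?\<rho> \<ge> 0" "?b \<ge> 0" by (simp_all add: radial_def flat_exp_bounds cutoff_bounds)
        have u: "\<bar>u \<xi>\<bar> = t powr c * ?b * ?\<rho>"
          using True nonneg by (simp add: u_def fields hardy_minimizer_def profile_def powr_def abs_mult)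
        have "(2 * ?r) powr p / t powr p * (t powr c * ?b * ?\<rho>) powr p
          = m (x, y, ln t / N n) powr p * (t powr (c * p) / t powr p)"
          using nonneg by (simp add: m_def powr_mult powr_powr mult_ac)
        also have "t powr (c * p) / t powr p = t powr ((c - 1) * p)"
          by (simp add: powr_diff[symmetric] algebra_simps)
        also have "\<dots> = 1 / t" using True by (simp add: c(2) powr_minus_divide)
        finally have "(2 * ?r) powr p / t powr p * (t powr c * ?b * ?\<rho>) powr p
          = m (x, y, ln t / N n) powr p / t" by simp
        moreover have "m (x, y, ln t / N n) = 0" if "(x, y, t) \<notin> ?QN"
          using that cyl[OF True] by (intro m_eq_0) auto
        ultimately show ?thesis
          using True p unfolding u unfolding fields angle_function_vertical
          by (cases "(x, y, t) \<in> ?QN") (simp_all add: H boundary_dist_def)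
      next
        case False
        then show ?thesis using QN_pos[of x y t] by (auto simp: fields H indicator_def)
      qed
    qed
    then have RHS: "(LINT \<xi>:?H|lborel. angle_function (0, 0, 1) \<xi> powr p / boundary_dist (0, 0, 1) 0 \<xi> powr p * \<bar>u \<xi>\<bar> powr p)
        = N n * J"
      unfolding set_lebesgue_integral_def J_def Q_def
      by (subst integral_log_cylinder(2)[symmetric, OF mp_cont _ N(1)]) (simp_all add: mult.commute)

    have grad: "norm (horizontal_gradient u (x, y, t)) powr p
        \<le> indicator ?QN (x, y, t) * ((c * m (x, y, ln t / N n) + k / N n) powr p / t)"
      if t: "t > 0" for x y t
    proof -
      define s where "s = ln t / N n"
      let ?r = "norm (x, y)" and ?\<rho> = "radial (x, y)" and ?\<rho>' = "flat_exp 2 (1 - (x, y) \<bullet> (x, y))"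
      have nonneg: "?\<rho> \<ge> 0" "cutoff s \<ge> 0" by (simp_all add: radial_def flat_exp_bounds cutoff_bounds)
      have le1: "?\<rho> \<le> 1" "cutoff s \<le> 1" by (simp_all add: radial_def flat_exp_bounds cutoff_bounds)
      have \<rho>': "?\<rho>' \<ge> 0" by (simp add: flat_exp_def)
      note g = horizontal_gradient_hardy_minimizer[OF t cutoff'(1) N(1), of c n x y,
          folded u_def s_def]
      show ?thesis
      proof (cases "(x, y, t) \<in> ?QN")
        case False
        then have "norm (x, y) > 1 \<or> s \<notin> {- 2.. - 1}"
          using cyl[OF t, of x y] by (auto simp: Q_def mem_cylinder s_def)
        then have "horizontal_gradient u (x, y, t) = 0"
          using norm_gt_1_imp[of "(x, y)"] cutoff_eq_0[of s] cutoff'(3)[of s]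
          unfolding g by (auto simp: radial_def flat_exp_def zero_prod_def simp del: inner_Pair atLeastAtMost_iff)
        then show ?thesis using False by simp
      next
        case True
        then have r: "?r \<le> 1" "t \<le> exp (- N n)" by (auto simp: mem_cylinder)
        have "1 - (x, y) \<bullet> (x, y) \<in> {0..1}"
          using r(1) inner_ge_zero[of "(x, y)"] by (simp add: norm_eq_sqrt_inner del: inner_ge_zero)
        from M2[OF this] have \<rho>'_le: "?\<rho>' \<le> M2" by linarith
        \<comment> \<open>The radial term carries \<open>t powr c\<close>, one factor
          \<open>t\<close> more than the main term; on the support
          \<open>t \<le> exp (- N n) \<le> 1 / N n\<close> turns it into an error of order
          \<open>1 / N n\<close>.\<close>
        have "N n \<le> exp (N n)" using exp_ge_add_one_self[of "N n"] by linarith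
        then have "exp (- N n) \<le> 1 / N n" using N[of n] by (simp add: exp_minus field_simps)
        then have tN: "t \<le> 1 / N n" using r(2) by linarith
        have tc: "t powr c = t powr (c - 1) * t" using t by (simp add: powr_diff)
        have norm_swap: "norm (y, - x) = ?r" by (simp add: norm_prod_def add.commute)
        have "norm (horizontal_gradient u (x, y, t))
          \<le> \<bar>2 * t powr (c - 1) * (c * cutoff s + cutoff' s / N n) * ?\<rho>\<bar> * ?r + \<bar>2 * t powr c * cutoff s * ?\<rho>'\<bar> * ?r"
          unfolding g by (rule order_trans[OF norm_triangle_ineq4]) (simp only: norm_scaleR norm_swap order_refl)
        also have "\<bar>2 * t powr (c - 1) * (c * cutoff s + cutoff' s / N n) * ?\<rho>\<bar> * ?r
          = t powr (c - 1) * (2 * \<bar>c * cutoff s + cutoff' s / N n\<bar> * (?\<rho> * ?r))"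
          using nonneg by (simp add: abs_mult)
        also have "\<bar>c * cutoff s + cutoff' s / N n\<bar> \<le> c * cutoff s + M1 / N n"
        proof -
          have "\<bar>c * cutoff s + cutoff' s / N n\<bar> \<le> \<bar>c * cutoff s\<bar> + \<bar>cutoff' s / N n\<bar>" by (rule abs_triangle_ineq)
          also have "\<dots> \<le> c * cutoff s + M1 / N n"
            using c nonneg N[of n] cutoff'(2)[of s] by (simp add: abs_mult divide_right_mono)
          finally show ?thesis .
        qed
        also have "t powr (c - 1) * (2 * (c * cutoff s + M1 / N n) * (?\<rho> * ?r))
          = t powr (c - 1) * (c * m (x, y, s) + 2 * (M1 / N n) * (?\<rho> * ?r))"
          by (simp add: m_def algebra_simps)
        also have "2 * (M1 / N n) * (?\<rho> * ?r) \<le> 2 * (M1 / N n) * 1"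
          using \<open>M1 \<ge> 0\<close> N[of n] le1 nonneg r by (intro mult_left_mono mult_le_one) auto
        also have "\<bar>2 * t powr c * cutoff s * ?\<rho>'\<bar> * ?r = t powr (c - 1) * (2 * t * (cutoff s * ?\<rho>' * ?r))"
          using nonneg \<rho>' t by (simp add: tc abs_mult mult_ac)
        also have "2 * t * (cutoff s * ?\<rho>' * ?r) \<le> 2 * (1 / N n) * (1 * M2 * 1)"
          using tN le1 r nonneg \<rho>' \<rho>'_le t \<open>M2 \<ge> 0\<close> N[of n] by (intro mult_mono) auto
        finally have "norm (horizontal_gradient u (x, y, t))
          \<le> t powr (c - 1) * (c * m (x, y, s) + 2 * (M1 / N n) * 1) + t powr (c - 1) * (2 * (1 / N n) * (1 * M2 * 1))"
          using t nonneg c N[of n] \<open>M1 \<ge> 0\<close> by (simp add: mult_left_mono mult_right_mono)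
        also have "\<dots> = t powr (c - 1) * (c * m (x, y, s) + k / N n)"
          by (simp add: k_def algebra_simps add_divide_distrib)
        finally have "norm (horizontal_gradient u (x, y, t)) powr p
          \<le> (t powr (c - 1) * (c * m (x, y, s) + k / N n)) powr p"
          using p by (intro powr_mono2) auto
        also have "\<dots> = t powr ((c - 1) * p) * (c * m (x, y, s) + k / N n) powr p"
          using m_nonneg c k N[of n] by (simp add: powr_mult powr_powr)
        also have "\<dots> = (c * m (x, y, s) + k / N n) powr p / t"
          using t by (simp add: c(2) powr_minus_divide)
        finally show ?thesis using True by (simp add: s_def)
      qed
    qed
    let ?G = "\<lambda>(x, y, t). indicator ?QN (x, y, t) * ((c * m (x, y, ln t / N n) + k / N n) powr p / t)"
    have "(LINT \<xi>:?H|lborel. norm (horizontal_gradient u \<xi>) powr p) \<le> integral\<^sup>L lborel ?G"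
      unfolding set_lebesgue_integral_def
    proof (rule integral_mono')
      show "integrable lborel ?G"
        by (rule integral_log_cylinder(1)[OF mk_cont _ N(1)]) simp
      fix \<xi> :: "'n heisenberg"
      obtain x y t where \<xi>: "\<xi> = (x, y, t)" by (cases \<xi>)
      show "0 \<le> ?G \<xi>" using QN_pos[of x y t] by (auto simp: \<xi> indicator_def)
      then show "indicator ?H \<xi> *\<^sub>R norm (horizontal_gradient u \<xi>) powr p \<le> ?G \<xi>"
        using grad[of t x y] by (cases "t > 0") (auto simp: \<xi> H)
    qed
    also have "\<dots> = N n * I n"
      unfolding I_def Q_def by (rule integral_log_cylinder(2)[OF mk_cont _ N(1)]) simp
    finally have "C * (N n * J) \<le> N n * I n"
      using hardy[of u] hardy_minimizer_test_function[OF N(1)] RHS unfolding u_def by fastforce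
    then have "N n * (C * J) \<le> N n * I n" by (simp only: mult_ac)
    then show ?thesis using N(1)[of n] by simp
  qed

  have int: "integrable lborel (\<lambda>\<xi>. indicator Q \<xi> * f \<xi>)" if "continuous_on UNIV f" for f :: "'n heisenberg \<Rightarrow> real"
    using borel_integrable_compact[OF Q continuous_on_subset[OF that]] by simp
  have "I \<longlonglongrightarrow> (\<integral>\<xi>. indicator Q \<xi> * (c * m \<xi> + 0) powr p \<partial>lborel)"
    unfolding I_def
  proof (rule integral_dominated_convergence)
    \<comment> \<open>The error \<open>k / N n\<close> is largest at \<open>n = 0\<close>, where
      \<open>N 0 = 1\<close>, so the first integrand dominates all others.\<close>
    show "integrable lborel (\<lambda>\<xi>. indicator Q \<xi> * (c * m \<xi> + k / N 0) powr p)"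
      by (rule int[OF mk_cont])
    show "AE \<xi> in lborel. (\<lambda>n. indicator Q \<xi> * (c * m \<xi> + k / N n) powr p) \<longlonglongrightarrow> indicator Q \<xi> * (c * m \<xi> + 0) powr p"
    proof (intro AE_I2 tendsto_mult tendsto_const tendsto_powr' tendsto_add)
      show "(\<lambda>n. k / N n) \<longlonglongrightarrow> 0"
        using tendsto_mult_right_zero[OF LIMSEQ_Suc[OF lim_1_over_n], of k] by (simp add: N_def)
    qed (use p k m_nonneg c N in \<open>auto intro!: always_eventually add_nonneg_nonneg divide_nonneg_pos\<close>)
    show "AE \<xi> in lborel. norm (indicator Q \<xi> * (c * m \<xi> + k / N n) powr p)
        \<le> indicator Q \<xi> * (c * m \<xi> + k / N 0) powr p" for n
    proof (rule AE_I2)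
      fix \<xi>
      have "k / N n \<le> k / N 0" using k by (intro divide_left_mono) (auto simp: N_def)
      then have "(c * m \<xi> + k / N n) powr p \<le> (c * m \<xi> + k / N 0) powr p"
        using p k c m_nonneg[of \<xi>] N[of n] by (intro powr_mono2) auto
      then show "norm (indicator Q \<xi> * (c * m \<xi> + k / N n) powr p)
          \<le> indicator Q \<xi> * (c * m \<xi> + k / N 0) powr p"
        by (simp add: indicator_def)
    qed
  qed (use int[OF mk_cont] int[OF continuous_on_powr'[OF continuous_on_mult[OF continuous_on_const m_cont] continuous_on_const]]
        p m_nonneg c in \<open>auto dest: borel_measurable_integrable\<close>)
  also have "(\<integral>\<xi>. indicator Q \<xi> * (c * m \<xi> + 0) powr p \<partial>lborel) = c powr p * J"
    unfolding J_def integral_mult_right_zero[symmetric]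
    using c m_nonneg by (intro Bochner_Integration.integral_cong) (auto simp: powr_mult)
  finally have lim: "I \<longlonglongrightarrow> c powr p * J" .
  have "C * J \<le> c powr p * J" using upper by (intro LIMSEQ_le_const[OF lim]) auto
  moreover have "J > 0"
  proof -
    \<comment> \<open>Dropping the indicator leaves a continuous integrand, as
      \<open>continuous_integral_zero\<close> requires.\<close>
    have eq: "(\<lambda>\<xi>. indicator Q \<xi> * m \<xi> powr p) = (\<lambda>\<xi>. m \<xi> powr p)"
      using m_eq_0 by (auto simp: fun_eq_iff indicator_def)
    have "J \<ge> 0" unfolding J_def by simp
    moreover have "J \<noteq> 0"
    proof
      assume "J = 0"
      then have "m \<xi> powr p = 0" for \<xi>
        using int[OF mp_cont] unfolding J_def eq by (intro continuous_integral_zero[OF mp_cont]) auto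
      then have "m \<xi> = 0" for \<xi> by simp
      \<comment> \<open>The point lies inside the support of all factors: horizontal norm
        \<open>1 / 2\<close>, neither 0 nor beyond the unit ball, and height at the midpoint of
        \<open>[-2, -1]\<close>. Here \<open>undefined\<close> merely names some coordinate
        index.\<close>
      then have "m ((1 / 2) *\<^sub>R axis undefined 1, 0, - 3 / 2) = 0" .
      then show False
        by (simp add: m_def cutoff_def radial_def flat_exp_def norm_Pair inner_axis_axis)
    qed
    ultimately show ?thesis by simp
  qed
  ultimately show ?thesis by (simp add: c_def)
qed

theorem corollary2p2:
  shows "(\<forall>(\<nu> :: 'n::finite heisenberg) (d :: real). norm \<nu> = 1 \<longrightarrow>
            (\<forall>(p :: real) > 1. \<forall>u \<in> test_functions (half_space \<nu> d).
               (LINT \<xi>:half_space \<nu> d|lborel. norm (horizontal_gradient u \<xi>) powr p)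
               \<ge> ((p - 1) / p) powr p *
                 (LINT \<xi>:half_space \<nu> d|lborel.
                    angle_function \<nu> \<xi> powr p / boundary_dist \<nu> d \<xi> powr p * \<bar>u \<xi>\<bar> powr p)))
       \<and> (\<forall>(p :: real) > 1. \<forall>C > ((p - 1) / p) powr p.
            \<not> (\<forall>(\<nu> :: 'n heisenberg) (d :: real). norm \<nu> = 1 \<longrightarrow>
                 (\<forall>u \<in> test_functions (half_space \<nu> d).
                    (LINT \<xi>:half_space \<nu> d|lborel. norm (horizontal_gradient u \<xi>) powr p)
                    \<ge> C *
                      (LINT \<xi>:half_space \<nu> d|lborel.
                         angle_function \<nu> \<xi> powr p / boundary_dist \<nu> d \<xi> powr p * \<bar>u \<xi>\<bar> powr p))))"
proof (intro conjI allI impI ballI)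
  fix \<nu> :: "'n heisenberg" and d p :: real and u
  assume "p > 1" "u \<in> test_functions (half_space \<nu> d)"
  then show "(LINT \<xi>:half_space \<nu> d|lborel. norm (horizontal_gradient u \<xi>) powr p)
      \<ge> ((p - 1) / p) powr p * (LINT \<xi>:half_space \<nu> d|lborel.
           angle_function \<nu> \<xi> powr p / boundary_dist \<nu> d \<xi> powr p * \<bar>u \<xi>\<bar> powr p)"
    by (rule hardy_half_space)
next
  fix p C :: real
  assume p: "p > 1" and C: "C > ((p - 1) / p) powr p"
  \<comment> \<open>A larger constant valid for all half-spaces would in particular hold for
    \<open>t > 0\<close>, whose unit normal this is.\<close>
  have unit: "norm ((0, 0, 1) :: 'n heisenberg) = 1" by simp
  show "\<not> (\<forall>(\<nu> :: 'n heisenberg) (d :: real). norm \<nu> = 1 \<longrightarrow>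
     (\<forall>u \<in> test_functions (half_space \<nu> d).
        (LINT \<xi>:half_space \<nu> d|lborel. norm (horizontal_gradient u \<xi>) powr p)
        \<ge> C * (LINT \<xi>:half_space \<nu> d|lborel.
             angle_function \<nu> \<xi> powr p / boundary_dist \<nu> d \<xi> powr p * \<bar>u \<xi>\<bar> powr p)))"
    (is "\<not> ?hardy")
  proof
    assume ?hardy
    then have "C \<le> ((p - 1) / p) powr p"
      by (intro hardy_half_space_sharp[OF p]) (use unit in blast)
    then show False using C by simp
  qed
qed

end
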